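(* Given the scenario tree structure of $\{\xi_t\}$ and a series of pairwise comparison ambiguity sets $\mathcal{U}^P(s)$, $s\in S^-$, the problem $$\max_{\{x(s),\,s\in S^-\}}\ \sum_{s\in S^-}p_s\inf_{u_s\in\mathcal{U}^P(s)}\Big(\sum_{i\in s^+}\frac{p_i}{p_s}u_s\big(h_{t(i)}(x(s),\xi(i))\big)\Big)\quad\text{s.t. }x(1)\in\mathscr{X}_1,\ x(s)\in\mathscr{X}_{t(s)}(x[s^-],\xi[s]),\ s\in S^-\setminus\{1\},$$ is equivalent to $$\max\ \sum_{s\in S^-}p_s\Big(\theta_{N-1}(s)+\sum_{i\in s^+}\mu_{i,N}-L(s)\sum_{j=1}^{N-1}\eta_j(s)+\sum_{k=1}^Kz_k(s)\big(\mathbb{P}[Y_k=y_N]-\mathbb{P}[W_k=y_N]\big)\lambda_k(s)\Big)$$ subject to $$\sum_{j=1}^Ny_j\mu_{i,j}\le\frac{p_i}{p_{i^-}}h_{t(i)}(x(i^-),\xi(i)),\qquad\frac{p_i}{p_{i^-}}-\sum_{j=1}^N\mu_{i,j}=0,\qquad i\in S\setminus\{1\},$$ $$\theta_{j-1}(s)y_{j-1}-\theta_{j-1}(s)y_j+v_{j-2}(s)(y_{j-1}-y_{j-2})+\eta_{j-1}(s)\ge0,\quad j=3,\dots,N-1,\ s\in S^-,$$ $$\theta_1(s)y_1-\theta_1(s)y_2+\eta_1(s)\ge0,\quad s\in S^-,$$ $$\theta_{N-1}(s)y_{N-1}-\theta_{N-1}(s)y_N+v_{N-2}(s)(y_{N-1}-y_{N-2})+\eta_{N-1}(s)\ge0,\quad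 s\in S^-,$$ $$\theta_{j-1}(s)-\theta_j(s)+\sum_{i\in s^+}\mu_{i,j}-v_{j-1}(s)+v_j(s)+\sum_{k=1}^Kz_k(s)\big(\mathbb{P}[Y_k=y_j]-\mathbb{P}[W_k=y_j]\big)\lambda_k(s)=0,\quad j=2,\dots,N-2,\ s\in S^-,$$ $$\theta_{N-2}(s)-\theta_{N-1}(s)+\sum_{i\in s^+}\mu_{i,N-1}-v_{N-2}(s)+\sum_{k=1}^Kz_k(s)\big(\mathbb{P}[Y_k=y_{N-1}]-\mathbb{P}[W_k=y_{N-1}]\big)\lambda_k(s)=0,\quad s\in S^-,$$ $$x(1)\in\mathscr{X}_1,\quad x(s)\in\mathscr{X}_{t(s)}(x[s^-],\xi[s]),\ s\in S^-\setminus\{1\},$$ $$\theta(s)\in\mathbb{R}^{N-1},\ v(s)\in\mathbb{R}_+^{N-2},\ \eta(s)\in\mathbb{R}_+^{N-1},\ \lambda(s)\in\mathbb{R}_+^K,\ s\in S^-,\qquad\mu(s)=(\mu_{s,1},\dots,\mu_{s,N})\in\mathbb{R}_+^N,\ s\in S\setminus\{1\},$$ where the maximization is over $x(\cdot),\theta,v,\eta,\lambda,\mu$.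
   Context: Scenario tree: $S$ is the (finite) set of all nodes, node $1$ is the root, $S^-$ the set of non-leaf nodes; $s^-$ is the father node of $s$, $s^+$ the set of son nodes of $s$; $\xi(s)$ is the realization at $s$ and $\xi[s]$ the historical scenario from the root to $s$; $t(s)$ is the stage of $s$; $p_s$ is the appearing probability of node $s$; $x(s)$ is the decision at $s$ and $x[s]$ the historical decisions from the root to $s$. $h_t$ are continuous reward functions with range in $[a,b]$, and $\mathscr{X}_1$, $\mathscr{X}_t(\cdot,\cdot)$ are convex compact feasible sets. $\mathscr{U}^c$ is the set of continuous, non-decreasing, concave functions $u$ on $[a,b]$ with $u(a)=0$, $u(b)=1$. $(W_k,Y_k)$, $k=1,\dots,K$, are pairs of finitely supported prospects (random variables) with values in $[a,b]$; $y_1<\dots<y_N$ with $y_1=a$, $y_N=b$ is the ordered sequence of the points of $\{a\}\cup\bigcup_{k=1}^K(\mathrm{supp}(Y_k)\cup\mathrm{supp}(W_k))\cup\{b\}$. For each $s\in S^-$, $z_k(s)\in\{+1,-1,0\}$ encodes the decision maker's choice, $L(s)$ is a Lipschitz bound, and $$\mathcal{U}^P(s)=\{u\in\mathscr{U}^c:\ z_k(s)\mathbb{E}[u(W_k)]\ge z_k(s)\mathbb{E}[u(Y_k)],\ k=1,\dots,K,\ \mathrm{Lip}(u)\le L(s)\},$$ which is assumed nonempty; $\mathrm{Lip}(u)$ is the Lipschitz modulus of $u$. *)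

theory Defs
  imports "HOL-Probability.Probability"
begin

section \<open>Maximization problems\<close>

text \<open>A maximization problem is a feasible set with an objective. Its optimal value is an extended
  real, so that infeasible and unbounded problems are covered and no attainment is presupposed.\<close>

definition opt_value :: "'z set \<Rightarrow> ('z \<Rightarrow> real) \<Rightarrow> ereal" where
  "opt_value F f = (SUP z\<in>F. ereal (f z))"

definition maximizers :: "'z set \<Rightarrow> ('z \<Rightarrow> real) \<Rightarrow> 'z set" where
  "maximizers F f = {z \<in> F. \<forall>w\<in>F. f w \<le> f z}"

text \<open>Equivalence of a problem in \<open>x\<close> with a lifted problem in \<open>x\<close> and auxiliary variables, where
  \<open>\<pi>\<close> forgets the auxiliary variables. The last clause says that, for each feasible \<open>x\<close>, maximizing
  out the auxiliary variables recovers the original objective, and that this maximum is attained.\<close>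

definition equivalent_max_problems ::
    "('z \<Rightarrow> 'w) \<Rightarrow> 'w set \<Rightarrow> ('w \<Rightarrow> real) \<Rightarrow> 'z set \<Rightarrow> ('z \<Rightarrow> real) \<Rightarrow> bool" where
  "equivalent_max_problems \<pi> F f G g \<longleftrightarrow>
     opt_value F f = opt_value G g \<and>
     \<pi> ` G = F \<and>
     \<pi> ` maximizers G g = maximizers F f \<and>
     (\<forall>x\<in>F. \<exists>z \<in> maximizers {z \<in> G. \<pi> z = x} g. g z = f x)"

section \<open>Scenario trees\<close>

text \<open>Nodes are natural numbers, the root is \<open>1\<close>, and \<open>pa s\<close> is the father of a node
  \<open>s \<noteq> 1\<close>; the value \<open>pa 1\<close> is irrelevant.\<close>

definition sons :: "nat set \<Rightarrow> (nat \<Rightarrow> nat) \<Rightarrow> nat \<Rightarrow> nat set" where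
  "sons S pa s = {i \<in> S - {1}. pa i = s}"

definition nonleaf :: "nat set \<Rightarrow> (nat \<Rightarrow> nat) \<Rightarrow> nat set" where
  "nonleaf S pa = {s \<in> S. sons S pa s \<noteq> {}}"

definition scenario_tree :: "nat set \<Rightarrow> (nat \<Rightarrow> nat) \<Rightarrow> (nat \<Rightarrow> real) \<Rightarrow> bool" where
  "scenario_tree S pa p \<longleftrightarrow>
     finite S \<and> 1 \<in> S \<and>
     (\<forall>s \<in> S - {1}. pa s \<in> S) \<and>
     (\<forall>s \<in> S. \<exists>n. (pa ^^ n) s = 1) \<and>
     (\<forall>s \<in> S. 0 \<le> p s) \<and> p 1 = 1 \<and>
     (\<forall>s \<in> nonleaf S pa. 0 < p s \<and> (\<Sum>i \<in> sons S pa s. p i) = p s)"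

text \<open>The root has stage \<open>1\<close>.\<close>

definition stage :: "(nat \<Rightarrow> nat) \<Rightarrow> nat \<Rightarrow> nat" where
  "stage pa s = Suc (LEAST n. (pa ^^ n) s = 1)"

text \<open>The values of \<open>f\<close> along the path from the root to \<open>s\<close>, both ends included and starting at
  the root: \<open>hist pa \<xi> s\<close> is $\xi[s]$ and \<open>hist pa x s\<close> is $x[s]$.\<close>

definition hist :: "(nat \<Rightarrow> nat) \<Rightarrow> (nat \<Rightarrow> 'd) \<Rightarrow> nat \<Rightarrow> 'd list" where
  "hist pa f s = rev (map (\<lambda>n. f ((pa ^^ n) s)) [0..<stage pa s])"

section \<open>Pairwise comparison ambiguity sets\<close>

text \<open>Utility functions on the interval from \<open>a\<close> to \<open>b\<close> are represented by total functions; their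
  values outside the interval are unconstrained and are never used.\<close>

definition utilities :: "real \<Rightarrow> real \<Rightarrow> (real \<Rightarrow> real) set" where
  "utilities a b = {u. continuous_on {a..b} u \<and> mono_on {a..b} u \<and> concave_on {a..b} u \<and>
                       u a = 0 \<and> u b = 1}"

text \<open>The least Lipschitz constant, and infinity for a function that is not Lipschitz.\<close>

definition lip_modulus :: "real set \<Rightarrow> (real \<Rightarrow> real) \<Rightarrow> ereal" where
  "lip_modulus A u = (INF C \<in> {C. C-lipschitz_on A u}. ereal C)"

text \<open>Prospects enter only through their laws, which are given as probability mass functions.
  The arguments \<open>zs\<close> and \<open>Ls\<close> are the choices and the Lipschitz bound at the node considered.\<close>

definition ambiguity_set ::
    "real \<Rightarrow> real \<Rightarrow> nat \<Rightarrow> (nat \<Rightarrow> real pmf) \<Rightarrow> (nat \<Rightarrow> real pmf) \<Rightarrow>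
     (nat \<Rightarrow> real) \<Rightarrow> real \<Rightarrow> (real \<Rightarrow> real) set" where
  "ambiguity_set a b K W Y zs Ls =
     {u \<in> utilities a b.
        (\<forall>k\<in>{1..K}. zs k * measure_pmf.expectation (W k) u \<ge> zs k * measure_pmf.expectation (Y k) u) \<and>
        lip_modulus {a..b} u \<le> ereal Ls}"

definition breakpoints ::
    "real \<Rightarrow> real \<Rightarrow> nat \<Rightarrow> (nat \<Rightarrow> real pmf) \<Rightarrow> (nat \<Rightarrow> real pmf) \<Rightarrow> real set" where
  "breakpoints a b K W Y = {a} \<union> (\<Union>k\<in>{1..K}. set_pmf (Y k) \<union> set_pmf (W k)) \<union> {b}"

section \<open>The robust problem\<close>

text \<open>A policy is a total function on nodes; only its values at non-leaf nodes matter.\<close>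

definition feasible_policy ::
    "nat set \<Rightarrow> (nat \<Rightarrow> nat) \<Rightarrow> (nat \<Rightarrow> 'c) \<Rightarrow> 'x set \<Rightarrow> (nat \<Rightarrow> 'x list \<Rightarrow> 'c list \<Rightarrow> 'x set) \<Rightarrow>
     (nat \<Rightarrow> 'x) \<Rightarrow> bool" where
  "feasible_policy S pa \<xi> X1 X x \<longleftrightarrow>
     x 1 \<in> X1 \<and>
     (\<forall>s \<in> nonleaf S pa - {1}. x s \<in> X (stage pa s) (hist pa x (pa s)) (hist pa \<xi> s))"

definition robust_objective ::
    "nat set \<Rightarrow> (nat \<Rightarrow> nat) \<Rightarrow> (nat \<Rightarrow> real) \<Rightarrow> (nat \<Rightarrow> 'c) \<Rightarrow> (nat \<Rightarrow> 'x \<Rightarrow> 'c \<Rightarrow> real) \<Rightarrow>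
     (nat \<Rightarrow> (real \<Rightarrow> real) set) \<Rightarrow> (nat \<Rightarrow> 'x) \<Rightarrow> real" where
  "robust_objective S pa p \<xi> h U x =
     (\<Sum>s \<in> nonleaf S pa. p s *
        (INF u \<in> U s. \<Sum>i \<in> sons S pa s. p i / p s * u (h (stage pa i) (x s) (\<xi> i))))"

section \<open>The reformulation\<close>

text \<open>The variables are \<open>(x, \<theta>, v, \<eta>, lam, \<mu>)\<close>, with a node as first and a component (counted from
  \<open>1\<close>) as second argument of the last five. They are total functions; only the entries
  \<open>\<theta> s j\<close> and \<open>\<eta> s j\<close> with \<open>j \<in> {1..N - 1}\<close>, \<open>v s j\<close> with \<open>j \<in> {1..N - 2}\<close>, \<open>lam s k\<close> with
  \<open>k \<in> {1..K}\<close> (for non-leaf \<open>s\<close>) and \<open>\<mu> i j\<close> with \<open>j \<in> {1..N}\<close> (for non-root \<open>i\<close>) occur.\<close>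

type_synonym 'x lifted =
  "(nat \<Rightarrow> 'x) \<times> (nat \<Rightarrow> nat \<Rightarrow> real) \<times> (nat \<Rightarrow> nat \<Rightarrow> real) \<times> (nat \<Rightarrow> nat \<Rightarrow> real) \<times>
   (nat \<Rightarrow> nat \<Rightarrow> real) \<times> (nat \<Rightarrow> nat \<Rightarrow> real)"

definition lifted_objective ::
    "nat set \<Rightarrow> (nat \<Rightarrow> nat) \<Rightarrow> (nat \<Rightarrow> real) \<Rightarrow> nat \<Rightarrow> (nat \<Rightarrow> real pmf) \<Rightarrow> (nat \<Rightarrow> real pmf) \<Rightarrow>
     nat \<Rightarrow> (nat \<Rightarrow> real) \<Rightarrow> (nat \<Rightarrow> nat \<Rightarrow> real) \<Rightarrow> (nat \<Rightarrow> real) \<Rightarrow> 'x lifted \<Rightarrow> real" where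
  "lifted_objective S pa p K W Y N y z L = (\<lambda>(x, \<theta>, v, \<eta>, lam, \<mu>).
     \<Sum>s \<in> nonleaf S pa. p s *
       (\<theta> s (N - 1) + (\<Sum>i \<in> sons S pa s. \<mu> i N) - L s * (\<Sum>j = 1..N - 1. \<eta> s j) +
        (\<Sum>k = 1..K. z s k * (pmf (Y k) (y N) - pmf (W k) (y N)) * lam s k)))"

text \<open>If \<open>N = 2\<close>, the slope constraint with index \<open>N - 1\<close> and the value constraint with index
  \<open>N - 1\<close> would refer to the nonexistent entries \<open>\<theta> s 0\<close>, \<open>v s 0\<close> and \<open>y 0\<close>; they are then
  absent. For \<open>N \<ge> 3\<close> the guards are void.\<close>

definition lifted_feasible ::
    "nat set \<Rightarrow> (nat \<Rightarrow> nat) \<Rightarrow> (nat \<Rightarrow> real) \<Rightarrow> (nat \<Rightarrow> 'c) \<Rightarrow> (nat \<Rightarrow> 'x \<Rightarrow> 'c \<Rightarrow> real) \<Rightarrow>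
     'x set \<Rightarrow> (nat \<Rightarrow> 'x list \<Rightarrow> 'c list \<Rightarrow> 'x set) \<Rightarrow>
     nat \<Rightarrow> (nat \<Rightarrow> real pmf) \<Rightarrow> (nat \<Rightarrow> real pmf) \<Rightarrow>
     nat \<Rightarrow> (nat \<Rightarrow> real) \<Rightarrow> (nat \<Rightarrow> nat \<Rightarrow> real) \<Rightarrow> 'x lifted set" where
  "lifted_feasible S pa p \<xi> h X1 X K W Y N y z = {(x, \<theta>, v, \<eta>, lam, \<mu>).
     (\<forall>i \<in> S - {1}.
        (\<Sum>j = 1..N. y j * \<mu> i j) \<le> p i / p (pa i) * h (stage pa i) (x (pa i)) (\<xi> i) \<and>
        p i / p (pa i) - (\<Sum>j = 1..N. \<mu> i j) = 0) \<and>
     (\<forall>s \<in> nonleaf S pa.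
        (\<forall>j \<in> {3..N - 1}.
           \<theta> s (j - 1) * y (j - 1) - \<theta> s (j - 1) * y j
           + v s (j - 2) * (y (j - 1) - y (j - 2)) + \<eta> s (j - 1) \<ge> 0) \<and>
        \<theta> s 1 * y 1 - \<theta> s 1 * y 2 + \<eta> s 1 \<ge> 0 \<and>
        (N \<ge> 3 \<longrightarrow>
           \<theta> s (N - 1) * y (N - 1) - \<theta> s (N - 1) * y N
           + v s (N - 2) * (y (N - 1) - y (N - 2)) + \<eta> s (N - 1) \<ge> 0) \<and>
        (\<forall>j \<in> {2..N - 2}.
           \<theta> s (j - 1) - \<theta> s j + (\<Sum>i \<in> sons S pa s. \<mu> i j) - v s (j - 1) + v s j
           + (\<Sum>k = 1..K. z s k * (pmf (Y k) (y j) - pmf (W k) (y j)) * lam s k) = 0) \<and>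
        (N \<ge> 3 \<longrightarrow>
           \<theta> s (N - 2) - \<theta> s (N - 1) + (\<Sum>i \<in> sons S pa s. \<mu> i (N - 1)) - v s (N - 2)
           + (\<Sum>k = 1..K. z s k * (pmf (Y k) (y (N - 1)) - pmf (W k) (y (N - 1))) * lam s k) = 0)) \<and>
     feasible_policy S pa \<xi> X1 X x \<and>
     (\<forall>s \<in> nonleaf S pa.
        (\<forall>j \<in> {1..N - 2}. v s j \<ge> 0) \<and> (\<forall>j \<in> {1..N - 1}. \<eta> s j \<ge> 0) \<and>
        (\<forall>k \<in> {1..K}. lam s k \<ge> 0)) \<and>
     (\<forall>i \<in> S - {1}. \<forall>j \<in> {1..N}. \<mu> i j \<ge> 0)}"

end

(* A utility in an ambiguity set may be replaced by its piecewise linear interpolant at the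
   breakpoints: this stays in the set, does not change the expectations of the prospects and only
   decreases the objective. The inner infimum at a node is therefore a finite linear program in the
   values and slopes at the breakpoints, where the value of the interpolant at h is the least value at h
   of a non-decreasing affine majorant. The lifted constraints at the node are its dual; weak duality is
   summation by parts together with Jensen's inequality, and strong duality with attainment is Farkas'
   lemma. The constraints at different nodes are coupled only through x, because every non-root node
   has exactly one father. *)

theory Submission
  imports Defs
begin

section \<open>Farkas' lemma\<close>

text \<open>The shape of the dual comes from keeping values and slopes at the breakpoints as
  separate variables and writing concavity in the mixed form slope(j+1) * (y(j+1) - y(j)) \<le>
  value(j+1) - value(j). Then \<theta> is the free multiplier of the link between values and slopes,
  v of concavity, \<eta> of the Lipschitz bound, lam of the comparisons, and \<mu> of the majorant
  constraints at the sons; the mixed form is why v occurs both in the slope inequalities and in the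
  value equations. The sign constraints on the slopes of the utility and of the majorants contribute
  only slack, which turns equations into inequalities. The obstacle is that the normalization u(b) =
  1 and the bound on the slopes are inhomogeneous. Both are homogenized by the value at b, at the
  price of a degenerate case where that value is 0. Farkas' lemma is applied with the infimum itself
  as a constant, so no minimizing utility has to be produced. Weak duality works directly with an
  arbitrary utility; interpolation serves strong duality alone.\<close>

definition linear_form :: "(('i \<Rightarrow> real) \<Rightarrow> real) \<Rightarrow> bool" where
  "linear_form f \<longleftrightarrow> (\<forall>x y c. f (\<lambda>i. x i + c * y i) = f x + c * f y)"

lemma linear_formD: "linear_form f \<Longrightarrow> f (\<lambda>i. x i + c * y i) = f x + c * f y"
  by (simp add: linear_form_def)

text \<open>Bartl's induction: if the functionals indexed by \<open>I\<close> do not suffice, some \<open>e\<close> witnesses this,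
  and then \<open>f k e < 0\<close>; projecting along \<open>e\<close> onto the kernel of \<open>f k\<close> removes \<open>f k\<close>.\<close>

lemma farkas:
  fixes g :: "('i \<Rightarrow> real) \<Rightarrow> real"
  assumes "finite I" and "\<And>i. i \<in> I \<Longrightarrow> linear_form (f i)" and "linear_form g"
    and "\<And>x. (\<And>i. i \<in> I \<Longrightarrow> 0 \<le> f i x) \<Longrightarrow> 0 \<le> g x"
  shows "\<exists>u. (\<forall>i\<in>I. 0 \<le> u i) \<and> (\<forall>x. g x = (\<Sum>i\<in>I. u i * f i x))"
  using assms
proof (induction I arbitrary: f g rule: finite_induct)
  case empty
  have "g x = 0" for x
  proof -
    \<comment> \<open>Linearity is available only in the form x + c * y, so -x is written as x +
      (-2) * x. Being nonnegative at both x and -x forces \<open>g\<close> to vanish.\<close>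
    have "g (\<lambda>i. x i + (-2) * x i) = - g x"
      by (subst linear_formD[OF empty(2)]) simp
    then show ?thesis
      using empty(3)[of x] empty(3)[of "\<lambda>i. x i + (-2) * x i"] by simp
  qed
  then show ?case by simp
next
  case (insert k I)
  show ?case
  proof (cases "\<forall>x. (\<forall>i\<in>I. 0 \<le> f i x) \<longrightarrow> 0 \<le> g x")
    case True
    then obtain u where u: "\<forall>i\<in>I. 0 \<le> u i" "\<forall>x. g x = (\<Sum>i\<in>I. u i * f i x)"
      using insert.IH[of f g] insert.prems by blast
    have "(\<Sum>i\<in>I. (u(k := 0)) i * f i x) = (\<Sum>i\<in>I. u i * f i x)" for x
      using insert.hyps(2) by (intro sum.cong) auto
    then show ?thesis
      using u insert.hyps by (intro exI[of _ "u(k := 0)"]) auto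
  next
    case False
    then obtain e where e: "\<And>i. i \<in> I \<Longrightarrow> 0 \<le> f i e" "g e < 0"
      by force
    have fk: "f k e < 0"
      using insert.prems(3)[of e] e by force
    define r where "r x = - (f k x / f k e)" for x
    define proj where "proj F x = F x + r x * F e" for F :: "('i \<Rightarrow> real) \<Rightarrow> real" and x
    have proj: "F (\<lambda>i. x i + r x * e i) = proj F x" if "linear_form F" for F x
      using that by (simp add: proj_def linear_formD)
    have lin: "linear_form (proj F)" if "linear_form F" for F
      using that insert.prems(1)[of k]
      by (auto simp: proj_def r_def linear_form_def algebra_simps add_divide_distrib)
    have "\<exists>u. (\<forall>i\<in>I. 0 \<le> u i) \<and> (\<forall>x. proj g x = (\<Sum>i\<in>I. u i * proj (f i) x))"
    proof (rule insert.IH)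
      fix x assume x: "\<And>i. i \<in> I \<Longrightarrow> 0 \<le> proj (f i) x"
      have "0 \<le> f i (\<lambda>i. x i + r x * e i)" if "i \<in> insert k I" for i
        using that x fk insert.prems(1)[of i] proj[of "f i" x]
        by (cases "i = k") (auto simp: proj_def r_def)
      from insert.prems(3)[OF this] show "0 \<le> proj g x"
        by (simp add: proj insert.prems(2))
    qed (use insert.prems lin in auto)
    then obtain u where u: "\<And>i. i \<in> I \<Longrightarrow> 0 \<le> u i"
      "\<And>x. proj g x = (\<Sum>i\<in>I. u i * proj (f i) x)"
      by blast
    \<comment> \<open>The multiplier of \<open>f k\<close>: solve the identity for
      \<open>proj g\<close> for \<open>g x\<close>, insert \<open>r x = - (f k x / f k e)\<close>
      and collect the terms in \<open>f k x\<close>. It is nonnegative because numerator and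
      denominator are both negative.\<close>
    define t where "t = (g e - (\<Sum>i\<in>I. u i * f i e)) / f k e"
    have "0 \<le> (\<Sum>i\<in>I. u i * f i e)"
      using u e by (intro sum_nonneg) simp
    then have t: "0 \<le> t"
      unfolding t_def using e fk by (intro divide_nonpos_neg) auto
    have g: "g x = t * f k x + (\<Sum>i\<in>I. u i * f i x)" for x
    proof -
      have "g x + r x * g e = (\<Sum>i\<in>I. u i * f i x) + r x * (\<Sum>i\<in>I. u i * f i e)"
        using u(2)[of x] by (simp add: proj_def algebra_simps sum.distrib sum_distrib_left)
      then show ?thesis
        using fk by (simp add: t_def r_def field_simps)
    qed
    have "(\<Sum>i\<in>I. (u(k := t)) i * f i x) = (\<Sum>i\<in>I. u i * f i x)" for x
      using insert.hyps(2) by (intro sum.cong) auto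
    then show ?thesis
      using u(1) t g insert.hyps by (intro exI[of _ "u(k := t)"]) auto
  qed
qed

text \<open>An equation is a pair of opposite inequalities; the difference of their two nonnegative
  multipliers is a multiplier of free sign.\<close>

lemma farkas_eq:
  assumes fin: "finite I" "finite J"
    and lin: "\<And>i. i \<in> I \<Longrightarrow> linear_form (f i)" "\<And>j. j \<in> J \<Longrightarrow> linear_form (e j)" "linear_form g"
    and imp: "\<And>x. (\<And>i. i \<in> I \<Longrightarrow> 0 \<le> f i x) \<Longrightarrow> (\<And>j. j \<in> J \<Longrightarrow> e j x = 0) \<Longrightarrow> 0 \<le> g x"
  obtains u w where "\<And>i. i \<in> I \<Longrightarrow> 0 \<le> u i"
    and "\<And>x. g x = (\<Sum>i\<in>I. u i * f i x) + (\<Sum>j\<in>J. w j * e j x)"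
proof -
  let ?F = "case_sum f (case_sum e (\<lambda>j x. - e j x))"
  have "\<exists>u. (\<forall>i \<in> I <+> (J <+> J). 0 \<le> u i) \<and> (\<forall>x. g x = (\<Sum>i \<in> I <+> (J <+> J). u i * ?F i x))"
  proof (rule farkas)
    show "linear_form (?F i)" if "i \<in> I <+> (J <+> J)" for i
      using that lin by (auto simp: linear_form_def)
    show "0 \<le> g x" if x: "\<And>i. i \<in> I <+> (J <+> J) \<Longrightarrow> 0 \<le> ?F i x" for x
    proof (rule imp)
      show "0 \<le> f i x" if "i \<in> I" for i
        using x[of "Inl i"] that by auto
      show "e j x = 0" if "j \<in> J" for j
        using x[of "Inr (Inl j)"] x[of "Inr (Inr j)"] that by fastforce
    qed
  qed (use fin lin in auto)
  then obtain u where u: "\<forall>i \<in> I <+> (J <+> J). 0 \<le> u i"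
    "\<And>x. g x = (\<Sum>i \<in> I <+> (J <+> J). u i * ?F i x)"
    by blast
  show ?thesis
  proof
    show "0 \<le> u (Inl i)" if "i \<in> I" for i
      using u(1) that by auto
    show "g x = (\<Sum>i\<in>I. u (Inl i) * f i x) + (\<Sum>j\<in>J. (u (Inr (Inl j)) - u (Inr (Inr j))) * e j x)" for x
      unfolding u(2) using fin by (simp add: sum.Plus o_def sum_negf sum_subtractf left_diff_distrib)
  qed
qed

section \<open>Utilities\<close>

lemma expectation_finite_support:
  fixes u :: "'a \<Rightarrow> real"
  assumes "finite A" "inj_on y A" "set_pmf M \<subseteq> y ` A"
  shows "measure_pmf.expectation M u = (\<Sum>j\<in>A. pmf M (y j) * u (y j))"
proof -
  have "measure_pmf.expectation M u = (\<Sum>x\<in>y ` A. pmf M x *\<^sub>R u x)"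
    using assms by (intro integral_measure_pmf) auto
  then show ?thesis
    using assms(2) by (simp add: sum.reindex)
qed

lemma lip_modulus_leI: "C-lipschitz_on A u \<Longrightarrow> lip_modulus A u \<le> ereal C"
  unfolding lip_modulus_def by (rule INF_lower) simp

lemma lip_modulus_leD:
  assumes "lip_modulus A u \<le> ereal C" "s \<in> A" "t \<in> A"
  shows "\<bar>u s - u t\<bar> \<le> C * \<bar>s - t\<bar>"
proof (cases "s = t")
  case False
  \<comment> \<open>The modulus is an extended real infimum, so the difference quotient is compared
    with every Lipschitz constant and thereby with the infimum.\<close>
  have "ereal (\<bar>u s - u t\<bar> / \<bar>s - t\<bar>) \<le> lip_modulus A u"
    unfolding lip_modulus_def
  proof (rule INF_greatest)
    fix c assume "c \<in> {C. C-lipschitz_on A u}"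
    then have "\<bar>u s - u t\<bar> \<le> c * \<bar>s - t\<bar>"
      using assms(2,3) by (auto simp: lipschitz_on_def dist_real_def)
    then show "ereal (\<bar>u s - u t\<bar> / \<bar>s - t\<bar>) \<le> ereal c"
      using False by (simp add: divide_le_eq)
  qed
  also note assms(1)
  finally show ?thesis
    using False by (simp add: divide_le_eq)
qed simp

lemma ambiguity_setD:
  assumes "u \<in> ambiguity_set a b K W Y zs C"
  shows "mono_on {a..b} u" "concave_on {a..b} u" "u a = 0" "u b = 1"
    and "\<And>s t. s \<in> {a..b} \<Longrightarrow> t \<in> {a..b} \<Longrightarrow> \<bar>u s - u t\<bar> \<le> C * \<bar>s - t\<bar>"
    and "\<And>k. k \<in> {1..K} \<Longrightarrow>
      zs k * measure_pmf.expectation (Y k) u \<le> zs k * measure_pmf.expectation (W k) u"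
  using assms lip_modulus_leD by (auto simp: ambiguity_set_def utilities_def)

text \<open>Supplies the lower bound 0 for the objective at a node, so that its real-valued infimum
  lies below each of its values.\<close>

lemma ambiguity_set_nonneg:
  assumes "u \<in> ambiguity_set a b K W Y zs C" "t \<in> {a..b}"
  shows "0 \<le> u t"
  using mono_onD[OF ambiguity_setD(1)[OF assms(1)], of a t] ambiguity_setD(3)[OF assms(1)] assms(2)
  by auto

text \<open>The weights \<open>w\<close> may all vanish, as a leaf may have probability zero.\<close>

lemma concave_mono_dominates:
  fixes u :: "real \<Rightarrow> real"
  assumes u: "mono_on {a..b} u" "concave_on {a..b} u" and "finite J"
    and w: "\<And>j. j \<in> J \<Longrightarrow> 0 \<le> w j" "(\<Sum>j\<in>J. w j) = q" and y: "\<And>j. j \<in> J \<Longrightarrow> y j \<in> {a..b}"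
    and le: "(\<Sum>j\<in>J. y j * w j) \<le> q * t" and t: "t \<in> {a..b}"
  shows "(\<Sum>j\<in>J. w j * u (y j)) \<le> q * u t"
proof (cases "q = 0")
  case True
  then have "\<forall>j\<in>J. w j = 0"
    using w sum_nonneg_eq_0_iff[OF \<open>finite J\<close>, of w] by auto
  then show ?thesis using True by simp
next
  case False
  then have q: "q > 0"
    using w sum_nonneg[of J w] by auto
  have J: "J \<noteq> {}" using w(2) False by auto
  \<comment> \<open>The mean of the normalized weights. Jensen's inequality reaches only
    \<open>u m\<close>; since \<open>m \<le> t\<close>, monotonicity carries the bound on to
    \<open>u t\<close>.\<close>
  define m where "m = (\<Sum>j\<in>J. (w j / q) *\<^sub>R y j)"
  have sum1: "(\<Sum>j\<in>J. w j / q) = 1"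
    using w(2) q by (simp flip: sum_divide_distrib)
  have m: "m \<in> {a..b}"
    unfolding m_def using \<open>finite J\<close> sum1 w(1) q y
    by (intro convex_sum) auto
  have "m = (\<Sum>j\<in>J. y j * w j) / q"
    by (simp add: m_def sum_divide_distrib mult.commute)
  then have "m \<le> t"
    using le q by (simp add: pos_divide_le_eq mult.commute)
  then have "u m \<le> u t"
    using mono_onD[OF u(1) m t] by simp
  moreover have "(\<Sum>j\<in>J. (w j / q) * u (y j)) \<le> u m"
    unfolding m_def using \<open>finite J\<close> J sum1 w(1) q y u(2) by (intro concave_on_sum) auto
  ultimately have "(\<Sum>j\<in>J. w j * u (y j)) / q \<le> u t"
    by (simp add: sum_divide_distrib)
  then show ?thesis
    using q by (simp add: pos_divide_le_eq mult.commute)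
qed

section \<open>Piecewise linear interpolation of concave grid values\<close>

lemma chord_interpolation_le:
  fixes t s s' c :: real
  assumes "s \<le> t" "t \<le> s'" "s < s'" "A + m * (s' - s) = A'" "A \<le> c * s + d" "A' \<le> c * s' + d"
  shows "A + m * (t - s) \<le> c * t + d"
proof -
  \<comment> \<open>Between the endpoints the chord is a convex combination of its end values, with
    weights proportional to s' - t and t - s, and so is the line. Multiplying by s' - s avoids
    fractions.\<close>
  have "(A + m * (t - s)) * (s' - s) = A * (s' - t) + A' * (t - s)"
    by (simp add: assms(4)[symmetric] algebra_simps)
  also have "\<dots> \<le> (c * s + d) * (s' - t) + (c * s' + d) * (t - s)"
    using assms by (intro add_mono mult_right_mono) auto
  also have "\<dots> = (c * t + d) * (s' - s)"
    by (simp add: algebra_simps)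
  finally show ?thesis
    using assms(3) by simp
qed

text \<open>The interpolant of concave grid values is the minimum of its chords.\<close>

lemma interpolating_utility:
  fixes y \<alpha> \<beta> :: "nat \<Rightarrow> real"
  assumes N: "2 \<le> N"
    and y: "\<And>j. j \<in> {1..N-1} \<Longrightarrow> y j < y (Suc j)" "y 1 = a" "y N = b"
    and \<alpha>: "\<alpha> 1 = 0" "\<alpha> N = 1"
      "\<And>j. j \<in> {1..N-1} \<Longrightarrow> \<alpha> (Suc j) - \<alpha> j = \<beta> j * (y (Suc j) - y j)"
    and \<beta>: "\<And>j. j \<in> {1..N-1} \<Longrightarrow> 0 \<le> \<beta> j \<and> \<beta> j \<le> C"
      "\<And>j. j \<in> {1..<N-1} \<Longrightarrow> \<beta> (Suc j) \<le> \<beta> j"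
  obtains u where "u \<in> utilities a b" "lip_modulus {a..b} u \<le> ereal C"
    and "\<And>j. j \<in> {1..N} \<Longrightarrow> u (y j) = \<alpha> j"
    and "\<And>t c d. t \<in> {a..b} \<Longrightarrow> (\<And>j. j \<in> {1..N} \<Longrightarrow> \<alpha> j \<le> c * y j + d) \<Longrightarrow> u t \<le> c * t + d"
proof -
  define l where "l j t = \<alpha> j + \<beta> j * (t - y j)" for j t
  define u where "u t = Min ((\<lambda>j. l j t) ` {1..N-1})" for t
  have ne: "{1..N-1} \<noteq> {}" using N by auto
  have u_le: "u t \<le> l j t" if "j \<in> {1..N-1}" for j t
    unfolding u_def using that by (intro Min_le) auto
  have u_ge: "x \<le> u t" if "\<And>j. j \<in> {1..N-1} \<Longrightarrow> x \<le> l j t" for x t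
    unfolding u_def using that ne by (subst Min_ge_iff) auto
  have u_at: "\<exists>j\<in>{1..N-1}. u t = l j t" for t
  proof -
    have "u t \<in> (\<lambda>j. l j t) ` {1..N-1}"
      unfolding u_def using ne by (intro Min_in) auto
    then show ?thesis by auto
  qed
  have anti: "\<beta> k \<le> \<beta> j" if "1 \<le> j" "j \<le> k" "k \<le> N - 1" for j k
    using that(2,3)
  proof (induction k rule: dec_induct)
    case (step n)
    then show ?case using \<beta>(2)[of n] that(1) by simp
  qed simp
  \<comment> \<open>Induction moving away from \<open>j\<close>: to the right the slopes are at most
    \<open>\<beta> j\<close>, to the left at least \<open>\<beta> j\<close>, so the j-th chord,
    extended to a line, stays above all grid values.\<close>
  have above: "\<alpha> m \<le> l j (y m)" if "j \<le> m" "1 \<le> j" "m \<le> N" "j \<le> N - 1" for j m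
    using that(1,3)
  proof (induction m rule: dec_induct)
    case base
    then show ?case by (simp add: l_def)
  next
    case (step n)
    have n: "n \<in> {1..N-1}" using step that by auto
    then have "\<beta> n * (y (Suc n) - y n) \<le> \<beta> j * (y (Suc n) - y n)"
      using anti[of j n] step that y(1)[of n] by (intro mult_right_mono) auto
    then show ?case
      using step \<alpha>(3)[OF n] by (simp add: l_def algebra_simps)
  qed
  have below: "\<alpha> m \<le> l j (y m)" if "m \<le> j" "1 \<le> m" "j \<le> N - 1" for j m
    using that(1,2)
  proof (induction m rule: inc_induct)
    case base
    then show ?case by (simp add: l_def)
  next
    case (step n)
    have n: "n \<in> {1..N-1}" using step that by auto
    then have "\<beta> j * (y (Suc n) - y n) \<le> \<beta> n * (y (Suc n) - y n)"
      using anti[of n j] step that y(1)[of n] by (intro mult_right_mono) auto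
    then show ?case
      using step \<alpha>(3)[OF n] by (simp add: l_def algebra_simps)
  qed
  have l_grid: "\<alpha> m \<le> l j (y m)" if "j \<in> {1..N-1}" "m \<in> {1..N}" for j m
    using above[of j m] below[of m j] that by (cases "j \<le> m") auto
  have u_grid: "u (y m) = \<alpha> m" if "m \<in> {1..N}" for m
  proof (rule antisym)
    show "\<alpha> m \<le> u (y m)"
      using l_grid that by (intro u_ge) auto
    show "u (y m) \<le> \<alpha> m"
    \<comment> \<open>No chord starts at the last grid point; there the chord ending at it is
      used.\<close>
    proof (cases "m = N")
      case True
      obtain M where M: "N = Suc M" "M \<in> {1..N-1}" using N by (cases N) auto
      have "u (y m) \<le> l M (y m)" by (rule u_le[OF M(2)])
      then show ?thesis using True M(1) \<alpha>(3)[OF M(2)] by (simp add: l_def)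
    next
      case False
      then have "u (y m) \<le> l m (y m)" using that by (intro u_le) auto
      then show ?thesis by (simp add: l_def)
    qed
  qed
  have C: "0 \<le> C" using \<beta>(1)[of 1] N by fastforce
  \<comment> \<open>The Lipschitz bound, monotonicity and concavity of the minimum are proved alike:
    take a chord attaining the minimum at the point whose value is to be bounded below, and use that
    \<open>u\<close> lies below this chord at the other points.\<close>
  have lip: "u s \<le> u t + C * \<bar>s - t\<bar>" for s t
  proof -
    obtain j where j: "j \<in> {1..N-1}" "u t = l j t" using u_at by blast
    have "\<beta> j * (s - t) \<le> C * \<bar>s - t\<bar>"
      using \<beta>(1)[OF j(1)] by (intro order_trans[OF mult_left_mono[OF abs_ge_self] mult_right_mono]) auto
    then show ?thesis
      using u_le[OF j(1), of s] j(2) by (simp add: l_def algebra_simps)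
  qed
  have lipschitz: "C-lipschitz_on {a..b} u"
  proof (rule lipschitz_onI[OF _ C])
    show "dist (u s) (u t) \<le> C * dist s t" for s t
      using lip[of s t] lip[of t s] by (simp add: dist_real_def abs_minus_commute abs_le_iff)
  qed
  have "mono_on {a..b} u"
  proof (rule mono_onI)
    fix s t :: real assume "s \<le> t"
    obtain j where j: "j \<in> {1..N-1}" "u t = l j t" using u_at by blast
    have "\<beta> j * (s - y j) \<le> \<beta> j * (t - y j)"
      using \<beta>(1)[OF j(1)] \<open>s \<le> t\<close> by (intro mult_left_mono) auto
    then show "u s \<le> u t"
      using u_le[OF j(1), of s] j(2) by (simp add: l_def)
  qed
  moreover have "concave_on {a..b} u"
  proof (rule concave_on_linorderI)
    fix t x x' :: real assume t: "0 < t" "t < 1"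
    obtain j where j: "j \<in> {1..N-1}" "u ((1 - t) *\<^sub>R x + t *\<^sub>R x') = l j ((1 - t) *\<^sub>R x + t *\<^sub>R x')"
      using u_at by blast
    have "(1 - t) * u x + t * u x' \<le> (1 - t) * l j x + t * l j x'"
      using t u_le[OF j(1)] by (intro add_mono mult_left_mono) auto
    then show "(1 - t) * u x + t * u x' \<le> u ((1 - t) *\<^sub>R x + t *\<^sub>R x')"
      unfolding j(2) by (simp add: l_def algebra_simps)
  qed simp
  ultimately have util: "u \<in> utilities a b"
    using lipschitz_on_continuous_on[OF lipschitz] u_grid[of 1] u_grid[of N] N \<alpha>(1,2) y(2,3)
    by (simp add: utilities_def)
  have line: "u t \<le> c * t + d"
    if t: "t \<in> {a..b}" and cd: "\<And>j. j \<in> {1..N} \<Longrightarrow> \<alpha> j \<le> c * y j + d" for t c d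
  proof -
    have "\<exists>j\<in>{1..N-1}. y j \<le> t \<and> t \<le> y (Suc j)"
    proof -
      \<comment> \<open>The last grid point not beyond \<open>t\<close> that starts a segment. If it
        is the last such point, \<open>t \<le> b\<close> replaces the maximality argument.\<close>
      define M where "M = Max {j \<in> {1..N-1}. y j \<le> t}"
      have "1 \<in> {j \<in> {1..N-1}. y j \<le> t}" using t y(2) N by simp
      then have M: "M \<in> {j \<in> {1..N-1}. y j \<le> t}"
        unfolding M_def by (intro Max_in) auto
      have "t \<le> y (Suc M)"
      proof (rule ccontr)
        assume *: "\<not> t \<le> y (Suc M)"
        then have "Suc M \<noteq> N" using t y(3) by auto
        then have "Suc M \<in> {j \<in> {1..N-1}. y j \<le> t}" using M * by auto
        then have "Suc M \<le> M" unfolding M_def by (intro Max_ge) auto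
        then show False by simp
      qed
      then show ?thesis using M by auto
    qed
    then obtain j where j: "j \<in> {1..N-1}" "y j \<le> t" "t \<le> y (Suc j)" by blast
    have "l j t \<le> c * t + d"
      unfolding l_def using j y(1)[OF j(1)] \<alpha>(3)[OF j(1)] cd[of j] cd[of "Suc j"]
      by (intro chord_interpolation_le[of "y j" t "y (Suc j)" _ _ "\<alpha> (Suc j)"]) auto
    then show ?thesis using u_le[OF j(1), of t] by simp
  qed
  show ?thesis
    using that[OF util lip_modulus_leI[OF lipschitz] u_grid line] by blast
qed

section \<open>Linear programming duality at a node\<close>

text \<open>\<open>D\<close> collects everything that multiplies the grid values apart from
  \<open>\<theta>\<close> and \<open>v\<close>, so the equations prescribe the increments of
  \<open>\<theta> - v\<close>. The multipliers \<open>v\<close> belong to the interior breakpoints;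
  padding them by 0 on both sides gives all constraints one form.\<close>

definition grid_dual ::
    "nat \<Rightarrow> (nat \<Rightarrow> real) \<Rightarrow> (nat \<Rightarrow> real) \<Rightarrow> (nat \<Rightarrow> real) \<Rightarrow> (nat \<Rightarrow> real) \<Rightarrow> (nat \<Rightarrow> real) \<Rightarrow> bool" where
  "grid_dual N y D \<theta> v \<eta> \<longleftrightarrow>
     v 0 = 0 \<and> v (N - 1) = 0 \<and>
     (\<forall>j\<in>{1..N-1}. 0 \<le> v j \<and> 0 \<le> \<eta> j \<and>
        \<theta> j * (y (Suc j) - y j) \<le> v (j - 1) * (y j - y (j - 1)) + \<eta> j) \<and>
     (\<forall>j\<in>{1..<N-1}. \<theta> (Suc j) - v (Suc j) = \<theta> j - v j + D (Suc j))"

text \<open>Summation by parts, with the differences of \<open>\<theta> - v\<close> given by \<open>D\<close>.\<close>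

lemma grid_dual_bound:
  assumes dual: "grid_dual N y D \<theta> v \<eta>" and N: "2 \<le> N"
    and y: "\<And>j. j \<in> {1..N-1} \<Longrightarrow> y j < y (Suc j)"
    and \<alpha>: "\<alpha> 1 = 0" "\<And>j. j \<in> {1..N-1} \<Longrightarrow> \<alpha> (Suc j) - \<alpha> j = \<beta> j * (y (Suc j) - y j)"
    and \<beta>: "\<And>j. j \<in> {1..N-1} \<Longrightarrow> 0 \<le> \<beta> j \<and> \<beta> j \<le> C"
      "\<And>j. j \<in> {1..<N-1} \<Longrightarrow> \<beta> (Suc j) \<le> \<beta> j"
  shows "(\<theta> (N - 1) + D N) * \<alpha> N - C * (\<Sum>j=1..N-1. \<eta> j) \<le> (\<Sum>j=1..N. D j * \<alpha> j)"
proof -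
  \<comment> \<open>The telescoping quantity: decreasing slopes bound the part of step n + 1 that
    involves \<open>v n\<close> by \<open>T n\<close>, which the \<open>v\<close> part of step n has
    already subtracted. The padding makes it vanish at both ends.\<close>
  define T where "T j = v j * (y (Suc j) - y j) * \<beta> j" for j
  \<comment> \<open>No equation constrains \<open>D 1\<close>; it enters the sum for free because
    \<open>\<alpha> 1 = 0\<close>.\<close>
  have parts: "(\<theta> n - v n) * \<alpha> (Suc n) =
      (\<Sum>j=1..n. (\<theta> j - v j) * (\<alpha> (Suc j) - \<alpha> j)) + (\<Sum>j=1..n. D j * \<alpha> j)"
    if "1 \<le> n" "n \<le> N - 1" for n
    using that
  proof (induction n rule: dec_induct)
    case base
    then show ?case using \<alpha>(1) by simp
  next
    case (step n)
    have w: "\<theta> (Suc n) - v (Suc n) = \<theta> n - v n + D (Suc n)"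
      using dual step by (simp add: grid_dual_def)
    have "(\<theta> (Suc n) - v (Suc n)) * \<alpha> (Suc (Suc n)) =
        (\<theta> (Suc n) - v (Suc n)) * (\<alpha> (Suc (Suc n)) - \<alpha> (Suc n)) +
        (\<theta> n - v n) * \<alpha> (Suc n) + D (Suc n) * \<alpha> (Suc n)"
      unfolding w by (simp add: algebra_simps)
    with step show ?case by simp
  qed
  have slopes: "(\<Sum>j=1..n. (\<theta> j - v j) * (\<alpha> (Suc j) - \<alpha> j)) \<le> C * (\<Sum>j=1..n. \<eta> j) - T n"
    if "n \<le> N - 1" for n
    using that
  proof (induction n)
    case 0
    then show ?case using dual by (simp add: T_def grid_dual_def)
  next
    case (Suc n)
    let ?j = "Suc n"
    have j: "?j \<in> {1..N-1}" using Suc by simp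
    have d: "\<theta> ?j * (y (Suc ?j) - y ?j) \<le> v n * (y ?j - y n) + \<eta> ?j" "0 \<le> \<eta> ?j"
      using dual[unfolded grid_dual_def] j by (force dest!: bspec[of _ _ ?j])+
    have "(\<theta> ?j - v ?j) * (\<alpha> (Suc ?j) - \<alpha> ?j) = \<theta> ?j * (y (Suc ?j) - y ?j) * \<beta> ?j - T ?j"
      unfolding \<alpha>(2)[OF j] by (simp add: T_def algebra_simps)
    also have "\<dots> \<le> (v n * (y ?j - y n) + \<eta> ?j) * \<beta> ?j - T ?j"
      using d(1) \<beta>(1)[OF j] by (intro diff_right_mono mult_right_mono) auto
    also have "\<dots> = v n * (y ?j - y n) * \<beta> ?j + \<eta> ?j * \<beta> ?j - T ?j"
      by (simp add: algebra_simps)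
    also have "\<dots> \<le> T n + \<eta> ?j * C - T ?j"
    proof -
      have "v n * (y ?j - y n) * \<beta> ?j \<le> T n"
      \<comment> \<open>At n = 0 nothing is known about \<open>y 0\<close> and
        \<open>\<beta> 0\<close>; \<open>v 0 = 0\<close> removes both.\<close>
      proof (cases "n = 0")
        case True
        then show ?thesis using dual by (simp add: T_def grid_dual_def)
      next
        case False
        then have "n \<in> {1..N-1}" "n \<in> {1..<N-1}" using Suc by auto
        then have "0 \<le> v n" "y n < y ?j" "\<beta> ?j \<le> \<beta> n"
          using dual y \<beta>(2) by (auto simp: grid_dual_def)
        then show ?thesis unfolding T_def by (intro mult_left_mono) auto
      qed
      moreover have "\<eta> ?j * \<beta> ?j \<le> \<eta> ?j * C"
        using d(2) \<beta>(1)[OF j] by (intro mult_left_mono) auto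
      ultimately show ?thesis by linarith
    qed
    finally show ?case
      using Suc by (simp add: algebra_simps)
  qed
  obtain M where M: "N = Suc M" "1 \<le> M" using N by (cases N) auto
  show ?thesis
    using parts[of M] slopes[of M] dual M by (simp add: T_def grid_dual_def algebra_simps)
qed

text \<open>The coefficient of the value at \<open>y j\<close> in the Lagrangian, up to the terms in
  \<open>\<theta>\<close> and \<open>v\<close>.\<close>

definition node_weight ::
    "nat \<Rightarrow> (nat \<Rightarrow> real pmf) \<Rightarrow> (nat \<Rightarrow> real pmf) \<Rightarrow> (nat \<Rightarrow> real) \<Rightarrow> (nat \<Rightarrow> real) \<Rightarrow>
     nat set \<Rightarrow> (nat \<Rightarrow> nat \<Rightarrow> real) \<Rightarrow> (nat \<Rightarrow> real) \<Rightarrow> nat \<Rightarrow> real" where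
  "node_weight K W Y y zs I \<mu> lam j =
     (\<Sum>i\<in>I. \<mu> i j) + (\<Sum>k=1..K. zs k * (pmf (Y k) (y j) - pmf (W k) (y j)) * lam k)"

text \<open>The row \<open>\<mu> i\<close> is a measure of mass \<open>q i\<close> on the grid with
  first moment at most \<open>q i * g i\<close>. Every non-decreasing concave utility therefore
  ranks it below the sure amount \<open>g i\<close>.\<close>

definition node_dual ::
    "nat \<Rightarrow> (nat \<Rightarrow> real pmf) \<Rightarrow> (nat \<Rightarrow> real pmf) \<Rightarrow> nat \<Rightarrow> (nat \<Rightarrow> real) \<Rightarrow> (nat \<Rightarrow> real) \<Rightarrow> nat set \<Rightarrow>
     (nat \<Rightarrow> real) \<Rightarrow> (nat \<Rightarrow> real) \<Rightarrow> (nat \<Rightarrow> real) \<Rightarrow> (nat \<Rightarrow> real) \<Rightarrow> (nat \<Rightarrow> real) \<Rightarrow>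
     (nat \<Rightarrow> real) \<Rightarrow> (nat \<Rightarrow> nat \<Rightarrow> real) \<Rightarrow> bool" where
  "node_dual K W Y N y zs I q g \<theta> v \<eta> lam \<mu> \<longleftrightarrow>
     grid_dual N y (node_weight K W Y y zs I \<mu> lam) \<theta> v \<eta> \<and>
     (\<forall>k\<in>{1..K}. 0 \<le> lam k) \<and>
     (\<forall>i\<in>I. (\<forall>j\<in>{1..N}. 0 \<le> \<mu> i j) \<and> (\<Sum>j=1..N. \<mu> i j) = q i \<and>
        (\<Sum>j=1..N. y j * \<mu> i j) \<le> q i * g i)"

definition node_value ::
    "nat \<Rightarrow> (nat \<Rightarrow> real pmf) \<Rightarrow> (nat \<Rightarrow> real pmf) \<Rightarrow> nat \<Rightarrow> (nat \<Rightarrow> real) \<Rightarrow> (nat \<Rightarrow> real) \<Rightarrow> real \<Rightarrow>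
     nat set \<Rightarrow> (nat \<Rightarrow> real) \<Rightarrow> (nat \<Rightarrow> real) \<Rightarrow> (nat \<Rightarrow> real) \<Rightarrow> (nat \<Rightarrow> nat \<Rightarrow> real) \<Rightarrow> real" where
  "node_value K W Y N y zs C I \<theta> \<eta> lam \<mu> =
     \<theta> (N - 1) + node_weight K W Y y zs I \<mu> lam N - C * (\<Sum>j=1..N-1. \<eta> j)"

text \<open>Swapping the sums turns the weights back into expectations of the prospects, whose
  differences are controlled by the comparisons.\<close>

lemma sum_node_weight:
  "(\<Sum>j\<in>J. node_weight K W Y y zs I \<mu> lam j * \<alpha> j) =
    (\<Sum>i\<in>I. \<Sum>j\<in>J. \<mu> i j * \<alpha> j) +
    (\<Sum>k=1..K. lam k * (zs k * ((\<Sum>j\<in>J. pmf (Y k) (y j) * \<alpha> j) - (\<Sum>j\<in>J. pmf (W k) (y j) * \<alpha> j))))"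
proof -
  have "(\<Sum>j\<in>J. node_weight K W Y y zs I \<mu> lam j * \<alpha> j) =
      (\<Sum>j\<in>J. \<Sum>i\<in>I. \<mu> i j * \<alpha> j) +
      (\<Sum>j\<in>J. \<Sum>k=1..K. lam k * (zs k * (pmf (Y k) (y j) * \<alpha> j - pmf (W k) (y j) * \<alpha> j)))"
    by (simp add: node_weight_def sum.distrib sum_distrib_right distrib_right)
      (simp add: algebra_simps)
  also have "\<dots> = (\<Sum>i\<in>I. \<Sum>j\<in>J. \<mu> i j * \<alpha> j) +
      (\<Sum>k=1..K. \<Sum>j\<in>J. lam k * (zs k * (pmf (Y k) (y j) * \<alpha> j - pmf (W k) (y j) * \<alpha> j)))"
    by (intro arg_cong2[of _ _ _ _ "(+)"] sum.swap)
  finally show ?thesis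
    by (simp add: sum_subtractf flip: sum_distrib_left)
qed

text \<open>The variables of the primal program: values and slopes at the breakpoints, and one
  affine majorant for each son. A point is a function on this type, so four kinds of variables share
  one space; index ranges appear only in the constraints.\<close>

datatype lp_var = Val nat | Slope nat | Line_slope nat | Line_icpt nat

text \<open>Holds the data common to all nodes; choices, Lipschitz bound, conditional probabilities
  and rewards remain parameters of the lemmas, as they vary with the node.\<close>

locale comparison_grid =
  fixes a b :: real and K N :: nat and W Y :: "nat \<Rightarrow> real pmf" and y :: "nat \<Rightarrow> real"
  assumes ab: "a < b"
    and W: "\<And>k. k \<in> {1..K} \<Longrightarrow> set_pmf (W k) \<subseteq> {a..b}"
    and Y: "\<And>k. k \<in> {1..K} \<Longrightarrow> set_pmf (Y k) \<subseteq> {a..b}"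
    and y_mono: "strict_mono_on {1..N} y"
    and y_set: "y ` {1..N} = breakpoints a b K W Y"
begin

lemma y_in:
  assumes "j \<in> {1..N}"
  shows "y j \<in> {a..b}"
proof -
  have "breakpoints a b K W Y \<subseteq> {a..b}"
    unfolding breakpoints_def using ab by (intro Un_least UN_least W Y) auto
  then show ?thesis
    using y_set assms by blast
qed

lemma y_less: "1 \<le> j \<Longrightarrow> j < k \<Longrightarrow> k \<le> N \<Longrightarrow> y j < y k"
  using strict_mono_onD[OF y_mono, of j k] by simp

lemma y_le: "1 \<le> j \<Longrightarrow> j \<le> k \<Longrightarrow> k \<le> N \<Longrightarrow> y j \<le> y k"
  using y_less[of j k] by (cases "j = k") auto

lemma y_ends: "2 \<le> N" "y 1 = a" "y N = b"
proof -
  have "a \<in> y ` {1..N}" "b \<in> y ` {1..N}"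
    unfolding y_set by (auto simp: breakpoints_def)
  then obtain i j where i: "i \<in> {1..N}" "y i = a" and j: "j \<in> {1..N}" "y j = b"
    by (metis imageE)
  have "i \<noteq> j" using i j ab by auto
  then show "2 \<le> N" using i j by auto
  then show "y 1 = a" "y N = b"
    using y_le[of 1 i] y_le[of j N] y_in[of 1] y_in[of N] i j by auto
qed

lemma y_step: "j \<in> {1..N-1} \<Longrightarrow> y j < y (Suc j)"
  by (intro y_less) auto

lemma expectation_grid:
  assumes "k \<in> {1..K}"
  shows "measure_pmf.expectation (W k) u = (\<Sum>j=1..N. pmf (W k) (y j) * u (y j))"
    and "measure_pmf.expectation (Y k) u = (\<Sum>j=1..N. pmf (Y k) (y j) * u (y j))"
proof -
  have "set_pmf (W k) \<subseteq> y ` {1..N}" "set_pmf (Y k) \<subseteq> y ` {1..N}"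
    unfolding y_set using assms by (auto simp: breakpoints_def)
  then show "measure_pmf.expectation (W k) u = (\<Sum>j=1..N. pmf (W k) (y j) * u (y j))"
    and "measure_pmf.expectation (Y k) u = (\<Sum>j=1..N. pmf (Y k) (y j) * u (y j))"
    using strict_mono_on_imp_inj_on[OF y_mono] by (auto intro!: expectation_finite_support)
qed

section \<open>Weak and strong duality on the breakpoint grid\<close>

lemma weak_duality:
  assumes u: "u \<in> ambiguity_set a b K W Y zs C"
    and dual: "node_dual K W Y N y zs I q g \<theta> v \<eta> lam \<mu>"
    and g: "\<And>i. i \<in> I \<Longrightarrow> g i \<in> {a..b}"
  shows "node_value K W Y N y zs C I \<theta> \<eta> lam \<mu> \<le> (\<Sum>i\<in>I. q i * u (g i))"
proof -
  note u = ambiguity_setD[OF u]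
  \<comment> \<open>The summation by parts and the comparisons see \<open>u\<close> only through its
    grid values; Jensen's inequality then leads from the grid to the points \<open>g i\<close>.
    Hence \<open>u\<close> may be any member of the set.\<close>
  define \<alpha> where "\<alpha> j = u (y j)" for j
  define \<beta> where "\<beta> j = (\<alpha> (Suc j) - \<alpha> j) / (y (Suc j) - y j)" for j
  have \<alpha>: "\<alpha> 1 = 0" "\<alpha> N = 1"
    using u(3,4) y_ends by (simp_all add: \<alpha>_def)
  have slope: "\<alpha> (Suc j) - \<alpha> j = \<beta> j * (y (Suc j) - y j)" if "j \<in> {1..N-1}" for j
    using y_step[OF that] by (simp add: \<beta>_def)
  have \<beta>: "0 \<le> \<beta> j \<and> \<beta> j \<le> C" if j: "j \<in> {1..N-1}" for j
  proof -
    have "j \<in> {1..N}" "Suc j \<in> {1..N}" using j by auto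
    then have m: "y j \<in> {a..b}" "y (Suc j) \<in> {a..b}" by (blast intro: y_in)+
    have "\<alpha> j \<le> \<alpha> (Suc j)"
      using mono_onD[OF u(1) m] y_step[OF j] by (simp add: \<alpha>_def)
    moreover have "\<alpha> (Suc j) - \<alpha> j \<le> C * (y (Suc j) - y j)"
      using u(5)[OF m(2,1)] y_step[OF j] by (simp add: \<alpha>_def abs_le_iff)
    ultimately show ?thesis
      using y_step[OF j] by (simp add: \<beta>_def pos_divide_le_eq)
  qed
  have anti: "\<beta> (Suc j) \<le> \<beta> j" if j: "j \<in> {1..<N-1}" for j
  proof -
    have "j \<in> {1..N}" "Suc (Suc j) \<in> {1..N}" using j by auto
    then have m: "y j \<in> {a..b}" "y (Suc (Suc j)) \<in> {a..b}" by (blast intro: y_in)+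
    have s: "y j < y (Suc j)" "y (Suc j) < y (Suc (Suc j))" using j y_step by auto
    define d e where "d = y (Suc j) - y j" and "e = y (Suc (Suc j)) - y (Suc j)"
    have de: "0 < d" "0 < e" using s by (simp_all add: d_def e_def)
    \<comment> \<open>The weight that writes \<open>y (Suc j)\<close> as a convex combination of its
      two neighbours; multiplying by d + e later clears the denominators.\<close>
    define p where "p = d / (d + e)"
    have p: "0 \<le> p" "p \<le> 1" "p * (d + e) = d" "(1 - p) * (d + e) = e"
      using de by (simp_all add: p_def left_diff_distrib)
    have "(1 - p) * u (y j) + p * u (y (Suc (Suc j))) \<le> u ((1 - p) *\<^sub>R y j + p *\<^sub>R y (Suc (Suc j)))"
      using p m by (intro concave_onD[OF u(2)]) auto
    also have "(1 - p) *\<^sub>R y j + p *\<^sub>R y (Suc (Suc j)) = y j + p * (d + e)"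
      by (simp add: d_def e_def algebra_simps)
    also have "\<dots> = y (Suc j)" unfolding p(3) by (simp add: d_def)
    finally have "((1 - p) * \<alpha> j + p * \<alpha> (Suc (Suc j))) * (d + e) \<le> \<alpha> (Suc j) * (d + e)"
      unfolding \<alpha>_def using de by (intro mult_right_mono) auto
    moreover have "((1 - p) * \<alpha> j + p * \<alpha> (Suc (Suc j))) * (d + e) =
        ((1 - p) * (d + e)) * \<alpha> j + (p * (d + e)) * \<alpha> (Suc (Suc j))"
      by (simp add: algebra_simps)
    ultimately have "e * \<alpha> j + d * \<alpha> (Suc (Suc j)) \<le> \<alpha> (Suc j) * (d + e)"
      unfolding p(3,4) by simp
    then show ?thesis
      using de by (simp add: \<beta>_def flip: d_def e_def) (simp add: field_simps)
  qed
  have "node_value K W Y N y zs C I \<theta> \<eta> lam \<mu> \<le>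
      (\<Sum>j=1..N. node_weight K W Y y zs I \<mu> lam j * \<alpha> j)"
  proof -
    have "grid_dual N y (node_weight K W Y y zs I \<mu> lam) \<theta> v \<eta>"
      using dual by (simp add: node_dual_def)
    then have "(\<theta> (N - 1) + node_weight K W Y y zs I \<mu> lam N) * \<alpha> N - C * (\<Sum>j=1..N-1. \<eta> j)
        \<le> (\<Sum>j=1..N. node_weight K W Y y zs I \<mu> lam j * \<alpha> j)"
    proof (rule grid_dual_bound[OF _ y_ends(1)])
      show "y j < y (Suc j)" if "j \<in> {1..N-1}" for j by (rule y_step[OF that])
      show "\<alpha> 1 = 0" by (rule \<alpha>(1))
      show "\<alpha> (Suc j) - \<alpha> j = \<beta> j * (y (Suc j) - y j)" if "j \<in> {1..N-1}" for j
        by (rule slope[OF that])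
      show "0 \<le> \<beta> j \<and> \<beta> j \<le> C" if "j \<in> {1..N-1}" for j by (rule \<beta>[OF that])
      show "\<beta> (Suc j) \<le> \<beta> j" if "j \<in> {1..<N-1}" for j by (rule anti[OF that])
    qed
    then show ?thesis
      unfolding node_value_def \<alpha>(2) mult_1_right .
  qed
  also have "\<dots> \<le> (\<Sum>i\<in>I. \<Sum>j=1..N. \<mu> i j * \<alpha> j)"
  proof -
    have "(\<Sum>k=1..K. lam k * (zs k *
        ((\<Sum>j=1..N. pmf (Y k) (y j) * \<alpha> j) - (\<Sum>j=1..N. pmf (W k) (y j) * \<alpha> j)))) \<le> 0"
    proof (rule sum_nonpos, rule mult_nonneg_nonpos)
      fix k assume k: "k \<in> {1..K}"
      show "0 \<le> lam k" using dual k by (simp add: node_dual_def)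
      show "zs k * ((\<Sum>j=1..N. pmf (Y k) (y j) * \<alpha> j) - (\<Sum>j=1..N. pmf (W k) (y j) * \<alpha> j)) \<le> 0"
        using u(6)[OF k] unfolding expectation_grid[OF k] \<alpha>_def by (simp add: right_diff_distrib)
    qed
    then show ?thesis
      by (simp only: sum_node_weight add_le_same_cancel1)
  qed
  also have "\<dots> \<le> (\<Sum>i\<in>I. q i * u (g i))"
  proof (rule sum_mono)
    fix i assume i: "i \<in> I"
    show "(\<Sum>j=1..N. \<mu> i j * \<alpha> j) \<le> q i * u (g i)"
      unfolding \<alpha>_def using dual i g y_in
      by (intro concave_mono_dominates[OF u(1,2)]) (auto simp: node_dual_def)
  qed
  finally show ?thesis .
qed

text \<open>The normalization \<open>\<alpha> N = 1\<close> is dropped and \<open>\<alpha> N\<close> serves as the homogenizing variable, so that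
  the homogeneous form of Farkas' lemma applies. The functions \<open>t \<mapsto> c i * t + d i\<close> are
  non-decreasing affine majorants of the grid values.\<close>

lemma lp_bound:
  assumes q: "\<And>i. i \<in> I \<Longrightarrow> 0 \<le> q i" and g: "\<And>i. i \<in> I \<Longrightarrow> g i \<in> {a..b}"
    and \<alpha>: "\<alpha> 1 = 0" "\<And>j. j \<in> {1..N-1} \<Longrightarrow> \<alpha> (Suc j) - \<alpha> j = \<beta> j * (y (Suc j) - y j)"
    and \<beta>: "\<And>j. j \<in> {1..N-1} \<Longrightarrow> 0 \<le> \<beta> j" "\<And>j. j \<in> {1..N-1} \<Longrightarrow> \<beta> j \<le> C * \<alpha> N"
      "\<And>j. j \<in> {1..N-2} \<Longrightarrow> \<beta> (Suc j) * (y (Suc j) - y j) \<le> \<alpha> (Suc j) - \<alpha> j"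
    and comparison: "\<And>k. k \<in> {1..K} \<Longrightarrow>
      0 \<le> zs k * ((\<Sum>j=1..N. pmf (W k) (y j) * \<alpha> j) - (\<Sum>j=1..N. pmf (Y k) (y j) * \<alpha> j))"
    and line: "\<And>i j. i \<in> I \<Longrightarrow> j \<in> {1..N} \<Longrightarrow> \<alpha> j \<le> c i * y j + d i" "\<And>i. i \<in> I \<Longrightarrow> 0 \<le> c i"
  shows "(INF u \<in> ambiguity_set a b K W Y zs C. \<Sum>i\<in>I. q i * u (g i)) * \<alpha> N
    \<le> (\<Sum>i\<in>I. q i * (c i * g i + d i))"
proof -
  let ?U = "ambiguity_set a b K W Y zs C"
  have mono: "\<alpha> j \<le> \<alpha> n" if "1 \<le> j" "j \<le> n" "n \<le> N" for j n
    using that(2,3)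
  proof (induction n rule: dec_induct)
    case (step n)
    then have n: "n \<in> {1..N-1}" using that(1) by auto
    then have "0 \<le> \<beta> n * (y (Suc n) - y n)"
      using y_step[OF n] \<beta>(1)[OF n] by (intro mult_nonneg_nonneg) auto
    then show ?case using step \<alpha>(2)[OF n] by simp
  qed simp
  show ?thesis
  proof (cases "\<alpha> N = 0")
    case True
    \<comment> \<open>No utility can be recovered by scaling here, but the left side is 0. Each
      majorant is nonnegative at \<open>a\<close>, where the grid value is 0, and hence at
      \<open>g i\<close>, since its slope is nonnegative.\<close>
    have "0 \<le> q i * (c i * g i + d i)" if i: "i \<in> I" for i
    proof -
      have "c i * a \<le> c i * g i"
        using line(2) g i by (intro mult_left_mono) auto
      moreover have "0 \<le> c i * a + d i"
        using line(1)[OF i, of 1] \<alpha>(1) y_ends by simp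
      ultimately show ?thesis using q i by simp
    qed
    then show ?thesis using True by (simp add: sum_nonneg)
  next
    case False
    then have pos: "0 < \<alpha> N"
      using mono[of 1 N] \<alpha>(1) y_ends by simp
    \<comment> \<open>Dividing by \<open>\<alpha> N\<close> restores the normalization. Mixed
      concavity becomes a decrease of slopes after cancelling the positive factor
      \<open>y (Suc j) - y j\<close>.\<close>
    have "\<beta> (Suc j) / \<alpha> N \<le> \<beta> j / \<alpha> N" if "j \<in> {1..<N-1}" for j
    proof -
      have j: "j \<in> {1..N-1}" "j \<in> {1..N-2}" using that by auto
      then have "\<beta> (Suc j) \<le> \<beta> j"
        using \<beta>(3)[OF j(2)] y_step[OF j(1)] unfolding \<alpha>(2)[OF j(1)] by simp
      then show ?thesis using pos by (simp add: divide_right_mono)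
    qed
    then obtain u where u: "u \<in> utilities a b" "lip_modulus {a..b} u \<le> ereal C"
      and u_y: "\<And>j. j \<in> {1..N} \<Longrightarrow> u (y j) = \<alpha> j / \<alpha> N"
      and u_le: "\<And>t c d. t \<in> {a..b} \<Longrightarrow> (\<And>j. j \<in> {1..N} \<Longrightarrow> \<alpha> j / \<alpha> N \<le> c * y j + d) \<Longrightarrow> u t \<le> c * t + d"
      using interpolating_utility[of N y a b "\<lambda>j. \<alpha> j / \<alpha> N" "\<lambda>j. \<beta> j / \<alpha> N" C]
        y_ends y_step \<alpha> \<beta>(1,2) pos
      by (simp add: pos_divide_le_eq flip: diff_divide_distrib) blast
    have "zs k * measure_pmf.expectation (Y k) u \<le> zs k * measure_pmf.expectation (W k) u"
      if k: "k \<in> {1..K}" for k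
    proof -
      have E: "(\<Sum>j=1..N. f j * u (y j)) = (\<Sum>j=1..N. f j * \<alpha> j) / \<alpha> N" for f
        by (simp add: u_y sum_divide_distrib)
      show ?thesis
        unfolding expectation_grid[OF k] E using comparison[OF k] pos
        by (simp add: right_diff_distrib divide_right_mono)
    qed
    then have u_in: "u \<in> ?U"
      using u by (simp add: ambiguity_set_def)
    have "bdd_below ((\<lambda>u. \<Sum>i\<in>I. q i * u (g i)) ` ?U)"
      using q g by (intro bdd_belowI2[of _ 0] sum_nonneg mult_nonneg_nonneg) (auto intro: ambiguity_set_nonneg)
    then have "(INF u\<in>?U. \<Sum>i\<in>I. q i * u (g i)) \<le> (\<Sum>i\<in>I. q i * u (g i))"
      using u_in by (rule cINF_lower)
    then have "(INF u\<in>?U. \<Sum>i\<in>I. q i * u (g i)) * \<alpha> N \<le> (\<Sum>i\<in>I. q i * u (g i)) * \<alpha> N"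
      using pos by (simp add: mult_right_mono)
    also have "\<dots> = (\<Sum>i\<in>I. q i * (u (g i) * \<alpha> N))"
      by (simp add: sum_distrib_right mult.assoc)
    also have "\<dots> \<le> (\<Sum>i\<in>I. q i * (c i * g i + d i))"
    proof (intro sum_mono mult_left_mono q)
      fix i assume i: "i \<in> I"
      have "u (g i) \<le> c i / \<alpha> N * g i + d i / \<alpha> N"
        using line(1)[OF i] g[OF i] pos
        by (intro u_le) (simp_all add: divide_right_mono flip: add_divide_distrib)
      then show "u (g i) * \<alpha> N \<le> c i * g i + d i"
        using pos by (simp add: pos_le_divide_eq flip: add_divide_distrib)
    qed
    finally show ?thesis .
  qed
qed

text \<open>By \<open>lp_bound\<close>, the inequality with the infimum \<open>V\<close> as a
  constant follows from the homogeneous primal constraints, so by Farkas it is a combination of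
  them. Comparing the coefficients of each variable yields dual feasibility and the value
  \<open>V\<close>, hence attainment.\<close>

lemma strong_duality:
  assumes fin: "finite I"
    and q: "\<And>i. i \<in> I \<Longrightarrow> 0 \<le> q i" and g: "\<And>i. i \<in> I \<Longrightarrow> g i \<in> {a..b}"
  shows "\<exists>\<theta> v \<eta> lam \<mu>. node_dual K W Y N y zs I q g \<theta> v \<eta> lam \<mu> \<and>
    node_value K W Y N y zs C I \<theta> \<eta> lam \<mu> =
      (INF u \<in> ambiguity_set a b K W Y zs C. \<Sum>i\<in>I. q i * u (g i))"
proof -
  define V where "V = (INF u \<in> ambiguity_set a b K W Y zs C. \<Sum>i\<in>I. q i * u (g i))"
  \<comment> \<open>The blocks are, in order: concavity, Lipschitz bound, monotonicity, comparisons,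
    majorants above the grid values, and non-decreasing majorants.\<close>
  let ?R = "{1..N-2} <+> {1..N-1} <+> {1..N-1} <+> {1..K} <+> (I \<times> {1..N}) <+> I"
  let ?f = "case_sum (\<lambda>j x. x (Val (Suc j)) - x (Val j) - x (Slope (Suc j)) * (y (Suc j) - y j))
    (case_sum (\<lambda>j x. C * x (Val N) - x (Slope j))
    (case_sum (\<lambda>j x. x (Slope j))
    (case_sum (\<lambda>k x. \<Sum>j=1..N. zs k * (pmf (W k) (y j) - pmf (Y k) (y j)) * x (Val j))
    (case_sum (\<lambda>(i, j) x. x (Line_slope i) * y j + x (Line_icpt i) - x (Val j))
    (\<lambda>i x. x (Line_slope i))))))"
  \<comment> \<open>The free multiplier of \<open>x (Val 1)\<close> absorbs the coefficient of that
    variable, which is why there is no dual equation at the first breakpoint.\<close>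
  let ?e = "case_sum (\<lambda>j x. x (Slope j) * (y (Suc j) - y j) - (x (Val (Suc j)) - x (Val j)))
    (\<lambda>_ x. x (Val 1))"
  let ?g = "\<lambda>x. (\<Sum>i\<in>I. q i * (x (Line_slope i) * g i + x (Line_icpt i))) - V * x (Val N)"
  obtain u w where u: "\<And>r. r \<in> ?R \<Longrightarrow> 0 \<le> u r"
    and id: "\<And>x. ?g x = (\<Sum>r\<in>?R. u r * ?f r x) + (\<Sum>r \<in> {1..N-1} <+> {()}. w r * ?e r x)"
  proof (rule farkas_eq[of ?R "{1..N-1} <+> {()}" ?f ?e ?g])
    show "linear_form (?f r)" if "r \<in> ?R" for r
      using that by (auto simp: linear_form_def algebra_simps sum.distrib sum_subtractf sum_distrib_left)
    show "linear_form (?e r)" if "r \<in> {1..N-1} <+> {()}" for r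
      using that by (auto simp: linear_form_def algebra_simps)
    show "linear_form ?g"
      by (simp add: linear_form_def algebra_simps sum.distrib sum_distrib_left)
    fix x assume f: "\<And>r. r \<in> ?R \<Longrightarrow> 0 \<le> ?f r x" and e: "\<And>r. r \<in> {1..N-1} <+> {()} \<Longrightarrow> ?e r x = 0"
    have "V * x (Val N) \<le> (\<Sum>i\<in>I. q i * (x (Line_slope i) * g i + x (Line_icpt i)))"
      unfolding V_def
    proof (rule lp_bound[OF q g])
      show "x (Val 1) = 0" using e[of "Inr ()"] by (simp add: InrI)
      show "x (Val (Suc j)) - x (Val j) = x (Slope j) * (y (Suc j) - y j)" if "j \<in> {1..N-1}" for j
        using e[of "Inl j"] that by (simp add: InlI)
      show "0 \<le> x (Slope j)" if "j \<in> {1..N-1}" for j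
        using f[of "Inr (Inr (Inl j))"] that by (simp add: InlI InrI)
      show "x (Slope j) \<le> C * x (Val N)" if "j \<in> {1..N-1}" for j
        using f[of "Inr (Inl j)"] that by (simp add: InlI InrI)
      show "x (Slope (Suc j)) * (y (Suc j) - y j) \<le> x (Val (Suc j)) - x (Val j)" if "j \<in> {1..N-2}" for j
        using f[of "Inl j"] that by (simp add: InlI InrI)
      show "0 \<le> zs k * ((\<Sum>j=1..N. pmf (W k) (y j) * x (Val j)) - (\<Sum>j=1..N. pmf (Y k) (y j) * x (Val j)))"
        if "k \<in> {1..K}" for k
        using f[of "Inr (Inr (Inr (Inl k)))"] that
        by (simp add: InlI InrI sum_subtractf left_diff_distrib right_diff_distrib mult.assoc flip: sum_distrib_left)
      show "x (Val j) \<le> x (Line_slope i) * y j + x (Line_icpt i)" if "i \<in> I" "j \<in> {1..N}" for i j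
        using f[of "Inr (Inr (Inr (Inr (Inl (i, j)))))"] that by (simp add: InlI InrI)
      show "0 \<le> x (Line_slope i)" if "i \<in> I" for i
        using f[of "Inr (Inr (Inr (Inr (Inr i))))"] that by (simp add: InlI InrI)
    qed
    then show "0 \<le> ?g x" by simp
  qed (use fin in auto)
  define \<theta> where "\<theta> j = w (Inl j)" for j
  define v where "v j = (if j \<in> {1..N-2} then u (Inl j) else 0)" for j
  define \<eta> where "\<eta> j = u (Inr (Inl j))" for j
  \<comment> \<open>\<open>\<rho>\<close> and, below, \<open>\<sigma>\<close> are slacks: they do
    not occur in the dual and turn the coefficient equations of the slopes into
    inequalities.\<close>
  define \<rho> where "\<rho> j = u (Inr (Inr (Inl j)))" for j
  define lam where "lam k = u (Inr (Inr (Inr (Inl k))))" for k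
  define \<mu> where "\<mu> i j = u (Inr (Inr (Inr (Inr (Inl (i, j))))))" for i j
  define \<sigma> where "\<sigma> i = u (Inr (Inr (Inr (Inr (Inr i)))))" for i
  have nonneg: "0 \<le> v j" "j \<in> {1..N-1} \<Longrightarrow> 0 \<le> \<eta> j" "j \<in> {1..N-1} \<Longrightarrow> 0 \<le> \<rho> j"
    "k \<in> {1..K} \<Longrightarrow> 0 \<le> lam k" "i \<in> I \<Longrightarrow> j \<in> {1..N} \<Longrightarrow> 0 \<le> \<mu> i j" "i \<in> I \<Longrightarrow> 0 \<le> \<sigma> i" for i j k
    unfolding v_def \<eta>_def \<rho>_def lam_def \<mu>_def \<sigma>_def by (auto intro!: u)
  have id: "?g x = (\<Sum>j=1..N-2. v j * (x (Val (Suc j)) - x (Val j) - x (Slope (Suc j)) * (y (Suc j) - y j)))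
      + (\<Sum>j=1..N-1. \<eta> j * (C * x (Val N) - x (Slope j)))
      + (\<Sum>j=1..N-1. \<rho> j * x (Slope j))
      + (\<Sum>k=1..K. lam k * (\<Sum>j=1..N. zs k * (pmf (W k) (y j) - pmf (Y k) (y j)) * x (Val j)))
      + (\<Sum>i\<in>I. \<Sum>j=1..N. \<mu> i j * (x (Line_slope i) * y j + x (Line_icpt i) - x (Val j)))
      + (\<Sum>i\<in>I. \<sigma> i * x (Line_slope i))
      + (\<Sum>j=1..N-1. \<theta> j * (x (Slope j) * (y (Suc j) - y j) - (x (Val (Suc j)) - x (Val j))))
      + w (Inr ()) * x (Val 1)" for x
    unfolding id using fin
    by (simp add: sum.Plus o_def sum.cartesian_product v_def \<theta>_def \<eta>_def \<rho>_def lam_def \<mu>_def \<sigma>_def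
        case_prod_unfold)
  have v0: "v 0 = 0" "v (N - 1) = 0" by (auto simp: v_def)
  have sum_v: "(\<Sum>j=1..N-2. v j * f j) = (\<Sum>j=1..N-1. v j * f j)" for f
    using v0 by (intro sum.mono_neutral_left) (auto simp: v_def)
  have delta: "(\<Sum>j\<in>J. f j * (if j = n then 1 else 0)) = (if n \<in> J then f n else 0)"
    "(\<Sum>j\<in>J. f j * ((if j = n then 1 else 0) * h j)) = (if n \<in> J then f n * h n else 0)"
    if "finite J" for f h :: "nat \<Rightarrow> real" and J n
    using that by (simp_all add: if_distrib[where f = "\<lambda>x. _ * x"] if_distrib[where f = "\<lambda>x. x * _"] cong: if_cong)
  \<comment> \<open>The identity holds at every point, so evaluating it at a unit vector extracts
    the coefficient of one variable; the facts up to \<open>lslope\<close> all arise this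
    way.\<close>
  have val: "\<theta> n - \<theta> (Suc n) + node_weight K W Y y zs I \<mu> lam (Suc n) - v n + v (Suc n) = 0"
    if n: "n \<in> {1..<N-1}" for n
  proof -
    have "N \<noteq> Suc n" "Suc n \<le> N" using n by auto
    then show ?thesis
      using id[of "\<lambda>r. if r = Val (Suc n) then 1 else 0"] n unfolding sum_v
      by (simp add: right_diff_distrib sum_subtractf sum.distrib delta node_weight_def sum_negf)
        (simp add: algebra_simps sum_subtractf)
  qed
  \<comment> \<open>The value at \<open>b\<close> also carries \<open>V\<close> and, through
    homogenization, the Lipschitz bound; its coefficient is thus the dual objective.\<close>
  have valN: "node_value K W Y N y zs C I \<theta> \<eta> lam \<mu> = V"
  proof -
    obtain M where M: "N = Suc M" "1 \<le> M" using y_ends(1) by (cases N) auto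
    then show ?thesis
      using id[of "\<lambda>r. if r = Val N then 1 else 0"] v0(2) unfolding sum_v
      by (simp add: right_diff_distrib sum_subtractf sum.distrib delta node_weight_def sum_negf node_value_def)
        (simp add: algebra_simps sum_subtractf sum_distrib_left)
  qed
  have slope: "\<theta> j * (y (Suc j) - y j) - v (j - 1) * (y j - y (j - 1)) - \<eta> j + \<rho> j = 0"
    if j: "j \<in> {1..N-1}" for j
  proof -
    \<comment> \<open>The slope at \<open>j\<close> occurs in the concavity row with index j - 1.
      For j = 1 there is no such row, in agreement with \<open>v 0 = 0\<close>.\<close>
    obtain m where m: "j = Suc m" using j by (cases j) auto
    show ?thesis
      using id[of "\<lambda>r. if r = Slope j then 1 else 0"] j v0(1) unfolding sum_v
      by (cases "m = 0") (auto simp: m left_diff_distrib right_diff_distrib sum_subtractf sum.distrib sum_negf delta)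
  qed
  have icpt: "(\<Sum>j=1..N. \<mu> i j) = q i" if "i \<in> I" for i
    using id[of "\<lambda>r. if r = Line_icpt i then 1 else 0"] that fin
    by (simp add: delta flip: sum_distrib_right)
  have lslope: "(\<Sum>j=1..N. y j * \<mu> i j) + \<sigma> i = q i * g i" if "i \<in> I" for i
  proof -
    have "(\<Sum>i'\<in>I. \<Sum>j=1..N. \<mu> i' j * ((if i' = i then 1 else 0) * y j)) =
        (\<Sum>i'\<in>I. if i' = i then \<Sum>j=1..N. \<mu> i j * y j else 0)"
      by (intro sum.cong) auto
    then show ?thesis
      using id[of "\<lambda>r. if r = Line_slope i then 1 else 0"] that fin
      by (simp add: delta) (simp add: mult.commute)
  qed
  have "grid_dual N y (node_weight K W Y y zs I \<mu> lam) \<theta> v \<eta>"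
    unfolding grid_dual_def
  proof (intro conjI ballI v0 nonneg)
    fix j assume "j \<in> {1..N-1}"
    then show "\<theta> j * (y (Suc j) - y j) \<le> v (j - 1) * (y j - y (j - 1)) + \<eta> j"
      using slope[of j] nonneg(3)[of j] by linarith
  next
    fix j assume "j \<in> {1..<N-1}"
    then show "\<theta> (Suc j) - v (Suc j) = \<theta> j - v j + node_weight K W Y y zs I \<mu> lam (Suc j)"
      using val[of j] by linarith
  qed
  moreover have "(\<Sum>j=1..N. y j * \<mu> i j) \<le> q i * g i" if "i \<in> I" for i
    using lslope nonneg(6) that by fastforce
  ultimately have "node_dual K W Y N y zs I q g \<theta> v \<eta> lam \<mu>"
    using nonneg icpt by (simp add: node_dual_def)
  then show ?thesis
    using valN unfolding V_def by blast
qed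

end

section \<open>The lifted problem\<close>

text \<open>An upper bound on each fibre together with an exact lift of each point determines the
  fibrewise maxima, and with them optimal values and maximizers.\<close>

lemma equivalent_max_problemsI:
  assumes proj: "\<And>w. w \<in> G \<Longrightarrow> \<pi> w \<in> F" and le: "\<And>w. w \<in> G \<Longrightarrow> g w \<le> f (\<pi> w)"
    and lift: "\<And>x. x \<in> F \<Longrightarrow> \<exists>w\<in>G. \<pi> w = x \<and> g w = f x"
  shows "equivalent_max_problems \<pi> F f G g"
  unfolding equivalent_max_problems_def
proof (intro conjI ballI)
  show "opt_value F f = opt_value G g"
    unfolding opt_value_def
  proof (rule antisym)
    show "(SUP x\<in>F. ereal (f x)) \<le> (SUP w\<in>G. ereal (g w))"
    proof (rule SUP_least)
      fix x assume "x \<in> F"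
      then obtain w where "w \<in> G" "g w = f x" using lift by blast
      then show "ereal (f x) \<le> (SUP w\<in>G. ereal (g w))"
        by (metis SUP_upper)
    qed
    show "(SUP w\<in>G. ereal (g w)) \<le> (SUP x\<in>F. ereal (f x))"
      using proj le by (intro SUP_mono) (metis ereal_less_eq(3))
  qed
  show "\<pi> ` G = F"
    using proj lift by blast
  show "\<pi> ` maximizers G g = maximizers F f"
  proof (intro equalityI subsetI)
    fix x assume "x \<in> \<pi> ` maximizers G g"
    then obtain w where w: "w \<in> G" "x = \<pi> w" and max: "\<And>w'. w' \<in> G \<Longrightarrow> g w' \<le> g w"
      by (auto simp: maximizers_def)
    have "f x' \<le> f x" if "x' \<in> F" for x'
      using lift[OF that] max le[OF w(1)] w(2) by fastforce
    then show "x \<in> maximizers F f"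
      using proj w by (auto simp: maximizers_def)
  next
    fix x assume x: "x \<in> maximizers F f"
    then obtain w where w: "w \<in> G" "\<pi> w = x" "g w = f x"
      using lift by (auto simp: maximizers_def)
    have "g w' \<le> g w" if "w' \<in> G" for w'
      using le[OF that] proj[OF that] x w(3) by (force simp: maximizers_def)
    then show "x \<in> \<pi> ` maximizers G g"
      using w by (auto simp: maximizers_def)
  qed
  fix x assume "x \<in> F"
  then obtain w where w: "w \<in> G" "\<pi> w = x" "g w = f x"
    using lift by blast
  then have "g w' \<le> g w" if "w' \<in> G" "\<pi> w' = x" for w'
    using le[OF that(1)] that(2) by simp
  then have "w \<in> maximizers {w \<in> G. \<pi> w = x} g"
    using w by (simp add: maximizers_def)
  then show "\<exists>w\<in>maximizers {w \<in> G. \<pi> w = x} g. g w = f x"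
    using w(3) by blast
qed

section \<open>The lifted constraints node by node\<close>

lemma grid_dual_restrict:
  assumes "grid_dual N y D \<theta> v \<eta>"
  shows "grid_dual N y D \<theta> (\<lambda>j. if j \<in> {1..N-2} then v j else 0) \<eta>"
proof -
  define v' where "v' j = (if j \<in> {1..N-2} then v j else 0)" for j
  have v': "v' j = v j" if "j \<le> N - 1" for j
  proof -
    \<comment> \<open>The constraints read \<open>v\<close> only up to index N - 1, and
      \<open>v\<close> already vanishes at the two padded indices.\<close>
    have "j \<in> {1..N-2} \<or> j = 0 \<or> j = N - 1" using that by auto
    then show ?thesis using assms by (auto simp: grid_dual_def v'_def)
  qed
  have "grid_dual N y D \<theta> v' \<eta>"
    using assms by (simp add: grid_dual_def v' le_diff_conv)
  then show ?thesis
    by (simp only: v'_def[abs_def])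
qed

text \<open>Setting \<open>v 0 = v (N - 1) = 0\<close> absorbs the boundary constraints, including those dropped
  for \<open>N = 2\<close>.\<close>

lemma grid_dual_iff:
  assumes N: "2 \<le> N"
  shows "grid_dual N y (\<lambda>j. A j + B j) \<theta> (\<lambda>j. if j \<in> {1..N-2} then v j else 0) \<eta> \<longleftrightarrow>
     (\<forall>j \<in> {3..N - 1}.
           \<theta> (j - 1) * y (j - 1) - \<theta> (j - 1) * y j
           + v (j - 2) * (y (j - 1) - y (j - 2)) + \<eta> (j - 1) \<ge> 0) \<and>
        \<theta> 1 * y 1 - \<theta> 1 * y 2 + \<eta> 1 \<ge> 0 \<and>
        (N \<ge> 3 \<longrightarrow>
           \<theta> (N - 1) * y (N - 1) - \<theta> (N - 1) * y N
           + v (N - 2) * (y (N - 1) - y (N - 2)) + \<eta> (N - 1) \<ge> 0) \<and>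
        (\<forall>j \<in> {2..N - 2}.
           \<theta> (j - 1) - \<theta> j + A j - v (j - 1) + v j + B j = 0) \<and>
        (N \<ge> 3 \<longrightarrow>
           \<theta> (N - 2) - \<theta> (N - 1) + A (N - 1) - v (N - 2) + B (N - 1) = 0) \<and>
     (\<forall>j \<in> {1..N - 2}. v j \<ge> 0) \<and> (\<forall>j \<in> {1..N - 1}. \<eta> j \<ge> 0)"
    (is "grid_dual _ _ _ _ ?v _ \<longleftrightarrow> ?S \<and> ?S1 \<and> ?SN \<and> ?E \<and> ?EN \<and> ?V \<and> ?H")
proof -
  have "grid_dual N y (\<lambda>j. A j + B j) \<theta> ?v \<eta> \<longleftrightarrow>
      ?V \<and> ?H \<and>
      (\<forall>j\<in>{1..N-1}. \<theta> j * (y (Suc j) - y j) \<le> ?v (j - 1) * (y j - y (j - 1)) + \<eta> j) \<and>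
      (\<forall>j\<in>{1..<N-1}. \<theta> (Suc j) - ?v (Suc j) = \<theta> j - ?v j + (A (Suc j) + B (Suc j)))"
    using N by (auto simp: grid_dual_def)
  moreover have "(\<forall>j\<in>{1..N-1}. \<theta> j * (y (Suc j) - y j) \<le> ?v (j - 1) * (y j - y (j - 1)) + \<eta> j) \<longleftrightarrow>
      ?S \<and> ?S1 \<and> ?SN"
  proof -
    \<comment> \<open>The stated constraint with index j concerns \<open>\<theta> (j - 1)\<close>,
      so the range from 3 to N - 1 covers 2 to N - 2 only. The two ends are separate and coincide
      for N = 2.\<close>
    have split: "(\<forall>j\<in>{1..N-1}. P j) \<longleftrightarrow> (\<forall>j\<in>{3..N-1}. P (j - 1)) \<and> P 1 \<and> (N \<ge> 3 \<longrightarrow> P (N - 1))" for P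
    proof (intro iffI conjI ballI impI)
      fix j assume *: "\<forall>j\<in>{1..N-1}. P j" and j: "j \<in> {3..N-1}"
      have "j - 1 \<in> {1..N-1}" using j unfolding atLeastAtMost_iff by linarith
      then show "P (j - 1)" using * by blast
    next
      fix j assume *: "(\<forall>j\<in>{3..N-1}. P (j - 1)) \<and> P 1 \<and> (N \<ge> 3 \<longrightarrow> P (N - 1))" and "j \<in> {1..N-1}"
      then have "j = 1 \<or> (N \<ge> 3 \<and> j = N - 1) \<or> Suc j \<in> {3..N-1}" by auto
      then show "P j" using * by (auto dest: bspec[of _ _ "Suc j"])
    qed (use N in auto)
    show ?thesis
      unfolding split
    proof (intro conj_cong ball_cong refl imp_cong)
      show "\<theta> (j - 1) * (y (Suc (j - 1)) - y (j - 1)) \<le> ?v (j - 1 - 1) * (y (j - 1) - y (j - 1 - 1)) + \<eta> (j - 1) \<longleftrightarrow>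
          0 \<le> \<theta> (j - 1) * y (j - 1) - \<theta> (j - 1) * y j + v (j - 2) * (y (j - 1) - y (j - 2)) + \<eta> (j - 1)"
        if "j \<in> {3..N-1}" for j
      proof -
        have "Suc (j - 1) = j" "j - 1 - 1 = j - 2" "j - 2 \<in> {1..N-2}"
          using that unfolding atLeastAtMost_iff by linarith+
        then show ?thesis by (simp only: right_diff_distrib if_True) linarith
      qed
      show "\<theta> 1 * (y (Suc 1) - y 1) \<le> ?v (1 - 1) * (y 1 - y (1 - 1)) + \<eta> 1 \<longleftrightarrow>
          0 \<le> \<theta> 1 * y 1 - \<theta> 1 * y 2 + \<eta> 1"
        by (simp add: right_diff_distrib numeral_2_eq_2) linarith
      show "\<theta> (N - 1) * (y (Suc (N - 1)) - y (N - 1)) \<le>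
            ?v (N - 1 - 1) * (y (N - 1) - y (N - 1 - 1)) + \<eta> (N - 1) \<longleftrightarrow>
          0 \<le> \<theta> (N - 1) * y (N - 1) - \<theta> (N - 1) * y N + v (N - 2) * (y (N - 1) - y (N - 2)) + \<eta> (N - 1)"
        if "3 \<le> N"
      proof -
        have "Suc (N - 1) = N" "N - 1 - 1 = N - 2" "N - 2 \<in> {1..N-2}"
          using that unfolding atLeastAtMost_iff by linarith+
        then show ?thesis by (simp only: right_diff_distrib if_True) linarith
      qed
    qed
  qed
  moreover have "(\<forall>j\<in>{1..<N-1}. \<theta> (Suc j) - ?v (Suc j) = \<theta> j - ?v j + (A (Suc j) + B (Suc j))) \<longleftrightarrow>
      ?E \<and> ?EN"
  proof -
    \<comment> \<open>The value equation at N - 1 stands apart because it has no term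
      \<open>v (N - 1)\<close>.\<close>
    have split: "(\<forall>j\<in>{1..<N-1}. P (Suc j)) \<longleftrightarrow> (\<forall>j\<in>{2..N-2}. P j) \<and> (N \<ge> 3 \<longrightarrow> P (N - 1))" for P
    proof (intro iffI conjI ballI impI)
      fix j assume *: "\<forall>j\<in>{1..<N-1}. P (Suc j)" and j: "j \<in> {2..N-2}"
      have "j - 1 \<in> {1..<N-1}" "Suc (j - 1) = j"
        using j unfolding atLeastAtMost_iff atLeastLessThan_iff by linarith+
      then show "P j" using * by metis
    next
      assume *: "\<forall>j\<in>{1..<N-1}. P (Suc j)" and "3 \<le> N"
      then have "N - 2 \<in> {1..<N-1}" "Suc (N - 2) = N - 1"
        unfolding atLeastLessThan_iff by linarith+
      then show "P (N - 1)" using * by metis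
    next
      fix j assume *: "(\<forall>j\<in>{2..N-2}. P j) \<and> (N \<ge> 3 \<longrightarrow> P (N - 1))" and "j \<in> {1..<N-1}"
      then have "(N \<ge> 3 \<and> Suc j = N - 1) \<or> Suc j \<in> {2..N-2}" by auto
      then show "P (Suc j)" using * by auto
    qed
    let ?P = "\<lambda>j. \<theta> j - ?v j = \<theta> (j - 1) - ?v (j - 1) + (A j + B j)"
    have "?P j \<longleftrightarrow> \<theta> (j - 1) - \<theta> j + A j - v (j - 1) + v j + B j = 0" if "j \<in> {2..N-2}" for j
    proof -
      have "j \<in> {1..N-2}" "j - 1 \<in> {1..N-2}"
        using that unfolding atLeastAtMost_iff by linarith+
      then show ?thesis by (simp only: if_True) linarith
    qed
    moreover have "?P (N - 1) \<longleftrightarrow> \<theta> (N - 2) - \<theta> (N - 1) + A (N - 1) - v (N - 2) + B (N - 1) = 0" if "3 \<le> N"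
    proof -
      have "N - 1 \<notin> {1..N-2}" "N - 2 \<in> {1..N-2}" "N - 1 - 1 = N - 2"
        using that unfolding atLeastAtMost_iff by linarith+
      then show ?thesis by (simp only: if_True if_False) linarith
    qed
    moreover have "(\<forall>j\<in>{1..<N-1}. \<theta> (Suc j) - ?v (Suc j) = \<theta> j - ?v j + (A (Suc j) + B (Suc j))) \<longleftrightarrow>
        (\<forall>j\<in>{2..N-2}. ?P j) \<and> (N \<ge> 3 \<longrightarrow> ?P (N - 1))"
      using split[of ?P] unfolding diff_Suc_1 .
    ultimately show ?thesis
      by (simp only: cong: ball_cong imp_cong)
  qed
  ultimately show ?thesis by argo
qed

text \<open>Only the rows of the sons are read; this allows the solutions found at the separate
  nodes to be glued into one global \<open>\<mu>\<close>.\<close>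

lemma node_dual_cong:
  assumes "\<And>i j. i \<in> I \<Longrightarrow> \<mu> i j = \<mu>' i j"
  shows "node_dual K W Y N y zs I q g \<theta> v \<eta> lam \<mu> \<longleftrightarrow> node_dual K W Y N y zs I q g \<theta> v \<eta> lam \<mu>'"
    and "node_value K W Y N y zs C I \<theta> \<eta> lam \<mu> = node_value K W Y N y zs C I \<theta> \<eta> lam \<mu>'"
proof -
  have "node_weight K W Y y zs I \<mu> lam = node_weight K W Y y zs I \<mu>' lam"
    using assms by (simp add: node_weight_def fun_eq_iff)
  then show "node_dual K W Y N y zs I q g \<theta> v \<eta> lam \<mu> \<longleftrightarrow> node_dual K W Y N y zs I q g \<theta> v \<eta> lam \<mu>'"
    and "node_value K W Y N y zs C I \<theta> \<eta> lam \<mu> = node_value K W Y N y zs C I \<theta> \<eta> lam \<mu>'"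
    using assms by (simp_all add: node_dual_def node_value_def)
qed

lemma node_dual_restrict:
  assumes "node_dual K W Y N y zs I q g \<theta> v \<eta> lam \<mu>"
  shows "node_dual K W Y N y zs I q g \<theta> (\<lambda>j. if j \<in> {1..N-2} then v j else 0) \<eta> lam \<mu>"
proof -
  from assms have "grid_dual N y (node_weight K W Y y zs I \<mu> lam) \<theta> v \<eta>"
    by (simp add: node_dual_def)
  from grid_dual_restrict[OF this] assms show ?thesis
    unfolding node_dual_def by blast
qed

lemma ball_nonroot_iff:
  assumes "scenario_tree S pa p"
  shows "(\<forall>i\<in>S - {1}. P i) \<longleftrightarrow> (\<forall>s\<in>nonleaf S pa. \<forall>i\<in>sons S pa s. P i)"
proof -
  have "pa i \<in> nonleaf S pa \<and> i \<in> sons S pa (pa i)" if "i \<in> S - {1}" for i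
    using assms that unfolding scenario_tree_def nonleaf_def sons_def by blast
  moreover have "i \<in> S - {1}" if "i \<in> sons S pa s" for i s
    using that by (simp add: sons_def)
  ultimately show ?thesis by blast
qed

text \<open>With \<open>v\<close> padded and the constraints on non-root nodes grouped by father,
  both sides consist of the same conjuncts in a different order.\<close>

lemma lifted_feasible_iff:
  assumes tree: "scenario_tree S pa p" and N: "2 \<le> N"
  shows "(x, \<theta>, v, \<eta>, lam, \<mu>) \<in> lifted_feasible S pa p \<xi> h X1 X K W Y N y z \<longleftrightarrow>
    feasible_policy S pa \<xi> X1 X x \<and>
    (\<forall>s\<in>nonleaf S pa. node_dual K W Y N y (z s) (sons S pa s) (\<lambda>i. p i / p s)
      (\<lambda>i. h (stage pa i) (x s) (\<xi> i)) (\<theta> s) (\<lambda>j. if j \<in> {1..N-2} then v s j else 0) (\<eta> s) (lam s) \<mu>)"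
proof -
  have pa: "pa i = s" if "i \<in> sons S pa s" for i s
    using that by (simp add: sons_def)
  have weight: "node_weight K W Y y zs I \<mu> l =
      (\<lambda>j. (\<Sum>i\<in>I. \<mu> i j) + (\<Sum>k=1..K. zs k * (pmf (Y k) (y j) - pmf (W k) (y j)) * l k))" for zs I l
    by (simp add: node_weight_def fun_eq_iff)
  have mass: "(\<Sum>j=1..N. \<mu> i j) = c \<longleftrightarrow> c - (\<Sum>j=1..N. \<mu> i j) = 0" for i c
    by auto
  show ?thesis
    unfolding lifted_feasible_def node_dual_def weight grid_dual_iff[OF N] mem_Collect_eq prod.case
      ball_nonroot_iff[OF tree]
    by (simp only: pa mass ball_conj_distrib conj_ac cong: ball_cong)
qed

lemma lifted_objective_eq:
  "lifted_objective S pa p K W Y N y z L (x, \<theta>, v, \<eta>, lam, \<mu>) =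
    (\<Sum>s\<in>nonleaf S pa. p s * node_value K W Y N y (z s) (L s) (sons S pa s) (\<theta> s) (\<eta> s) (lam s) \<mu>)"
  unfolding lifted_objective_def prod.case node_value_def node_weight_def
  by (intro sum.cong refl arg_cong2[of _ _ _ _ "(*)"]) simp

section \<open>Assembly over the scenario tree\<close>

theorem mainTheorem10:
  fixes S :: "nat set" and pa :: "nat \<Rightarrow> nat" and p :: "nat \<Rightarrow> real"
    and \<xi> :: "nat \<Rightarrow> 'c::euclidean_space"
    and h :: "nat \<Rightarrow> 'x::euclidean_space \<Rightarrow> 'c \<Rightarrow> real"
    and X1 :: "'x set" and X :: "nat \<Rightarrow> 'x list \<Rightarrow> 'c list \<Rightarrow> 'x set"
    and a b :: real
    and K N :: nat and W Y :: "nat \<Rightarrow> real pmf" and y :: "nat \<Rightarrow> real"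
    and z :: "nat \<Rightarrow> nat \<Rightarrow> real" and L :: "nat \<Rightarrow> real"
  assumes tree: "scenario_tree S pa p"
    and ab: "a < b"
    and h_cont: "\<And>t. continuous_on UNIV (\<lambda>(x, w). h t x w)"
    and h_range: "\<And>t x w. h t x w \<in> {a..b}"
    and X1: "convex X1" "compact X1"
    and X: "\<And>t xs ws. convex (X t xs ws)" "\<And>t xs ws. compact (X t xs ws)"
    and W: "\<And>k. k \<in> {1..K} \<Longrightarrow> finite (set_pmf (W k)) \<and> set_pmf (W k) \<subseteq> {a..b}"
    and Y: "\<And>k. k \<in> {1..K} \<Longrightarrow> finite (set_pmf (Y k)) \<and> set_pmf (Y k) \<subseteq> {a..b}"
    and y_mono: "strict_mono_on {1..N} y"
    and y_set: "y ` {1..N} = breakpoints a b K W Y"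
    and z: "\<And>s k. s \<in> nonleaf S pa \<Longrightarrow> k \<in> {1..K} \<Longrightarrow> z s k \<in> {1, -1, 0}"
    and nonempty: "\<And>s. s \<in> nonleaf S pa \<Longrightarrow> ambiguity_set a b K W Y (z s) (L s) \<noteq> {}"
  shows "equivalent_max_problems fst
           {x. feasible_policy S pa \<xi> X1 X x}
           (robust_objective S pa p \<xi> h (\<lambda>s. ambiguity_set a b K W Y (z s) (L s)))
           (lifted_feasible S pa p \<xi> h X1 X K W Y N y z)
           (lifted_objective S pa p K W Y N y z L)"
proof -
  interpret comparison_grid a b K N W Y y
    using ab W Y y_mono y_set by unfold_locales auto
  let ?G = "lifted_feasible S pa p \<xi> h X1 X K W Y N y z"
  let ?q = "\<lambda>s i. p i / p s" and ?g = "\<lambda>x s i. h (stage pa i) (x s) (\<xi> i)"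
  let ?U = "\<lambda>s. ambiguity_set a b K W Y (z s) (L s)"
  have fin: "finite (sons S pa s)" for s
    using tree by (simp add: scenario_tree_def sons_def)
  have p: "0 < p s" if "s \<in> nonleaf S pa" for s
    using tree that by (simp add: scenario_tree_def)
  have q: "0 \<le> ?q s i" if "s \<in> nonleaf S pa" "i \<in> sons S pa s" for s i
    using tree that by (simp add: scenario_tree_def sons_def nonleaf_def)
  show ?thesis
  proof (rule equivalent_max_problemsI)
    fix w assume w: "w \<in> ?G"
    obtain x \<theta> v \<eta> lam \<mu> where w_eq: "w = (x, \<theta>, v, \<eta>, lam, \<mu>)" by (cases w)
    note feas = w[unfolded w_eq lifted_feasible_iff[OF tree y_ends(1)]]
    show "fst w \<in> {x. feasible_policy S pa \<xi> X1 X x}"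
      using feas by (simp add: w_eq)
    show "lifted_objective S pa p K W Y N y z L w \<le> robust_objective S pa p \<xi> h ?U (fst w)"
      unfolding w_eq lifted_objective_eq robust_objective_def fst_conv
    \<comment> \<open>A common lower bound passes to a real infimum over a nonempty set; this is
      where \<open>nonempty\<close> enters.\<close>
    proof (intro sum_mono mult_left_mono cINF_greatest)
      fix s u assume s: "s \<in> nonleaf S pa" and u: "u \<in> ?U s"
      show "node_value K W Y N y (z s) (L s) (sons S pa s) (\<theta> s) (\<eta> s) (lam s) \<mu>
          \<le> (\<Sum>i\<in>sons S pa s. ?q s i * u (?g x s i))"
        using feas s by (intro weak_duality[OF u _ h_range]) blast
    qed (use nonempty p in \<open>auto intro: less_imp_le\<close>)
  next
    fix x assume "x \<in> {x. feasible_policy S pa \<xi> X1 X x}"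
    then have x: "feasible_policy S pa \<xi> X1 X x" by simp
    have "\<forall>s\<in>nonleaf S pa. \<exists>\<theta> v \<eta> lam \<mu>.
        node_dual K W Y N y (z s) (sons S pa s) (?q s) (?g x s) \<theta> v \<eta> lam \<mu> \<and>
        node_value K W Y N y (z s) (L s) (sons S pa s) \<theta> \<eta> lam \<mu> =
          (INF u\<in>?U s. \<Sum>i\<in>sons S pa s. ?q s i * u (?g x s i))"
      by (intro ballI strong_duality fin q h_range)
    then obtain \<theta> v \<eta> lam M where node: "\<forall>s\<in>nonleaf S pa.
        node_dual K W Y N y (z s) (sons S pa s) (?q s) (?g x s) (\<theta> s) (v s) (\<eta> s) (lam s) (M s) \<and>
        node_value K W Y N y (z s) (L s) (sons S pa s) (\<theta> s) (\<eta> s) (lam s) (M s) =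
          (INF u\<in>?U s. \<Sum>i\<in>sons S pa s. ?q s i * u (?g x s i))"
      unfolding bchoice_iff by (elim exE) (rule that)
    note dual = conjunct1[OF bspec[OF node]] and val = conjunct2[OF bspec[OF node]]
    \<comment> \<open>Each non-root node takes its row from the solution chosen at its father; there
      is no conflict, since different nodes have disjoint sets of sons.\<close>
    define \<mu> where "\<mu> i = M (pa i) i" for i
    have \<mu>: "M s i j = \<mu> i j" if "i \<in> sons S pa s" for s i j
      using that by (simp add: \<mu>_def sons_def)
    have "node_dual K W Y N y (z s) (sons S pa s) (?q s) (?g x s) (\<theta> s)
        (\<lambda>j. if j \<in> {1..N-2} then v s j else 0) (\<eta> s) (lam s) \<mu>" if "s \<in> nonleaf S pa" for s
      by (rule iffD1[OF node_dual_cong(1) node_dual_restrict[OF dual[OF that]]]) (rule \<mu>)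
    then have "(x, \<theta>, v, \<eta>, lam, \<mu>) \<in> ?G"
      unfolding lifted_feasible_iff[OF tree y_ends(1)] using x by blast
    moreover have "node_value K W Y N y (z s) (L s) (sons S pa s) (\<theta> s) (\<eta> s) (lam s) \<mu> =
        (INF u\<in>?U s. \<Sum>i\<in>sons S pa s. ?q s i * u (?g x s i))" if "s \<in> nonleaf S pa" for s
      by (rule trans[OF node_dual_cong(2)[symmetric] val[OF that]]) (rule \<mu>)
    then have "lifted_objective S pa p K W Y N y z L (x, \<theta>, v, \<eta>, lam, \<mu>) =
        robust_objective S pa p \<xi> h ?U x"
      unfolding lifted_objective_eq robust_objective_def
      by simp
    ultimately show "\<exists>w\<in>?G. fst w = x \<and>
        lifted_objective S pa p K W Y N y z L w = robust_objective S pa p \<xi> h ?U x"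
      by (intro bexI[of _ "(x, \<theta>, v, \<eta>, lam, \<mu>)"]) simp_all
  qed
qed

end
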